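(* Let $U\subset\mathbb{R}^2$ be open with coordinates $(x,y)$, let $h:U\to\mathbb{R}$ be a smooth positive function, and let $g_\Sigma=h^2(dx^2+dy^2)$ be the corresponding Riemannian metric on $U$, with volume form $\omega_\Sigma=h^2\,dx\wedge dy$. Let $H:U\to\mathbb{R}$ be a smooth positive function satisfying $$\Delta\ln H=(\ln H)_{xx}+(\ln H)_{yy}=2h^2\quad\text{on }U,$$ and put $l_2=-(\ln H)_y$, $n_2=(\ln H)_x$. Let $N=\{(z,t)\in\mathbb{R}^2: z<0\}$ and $M=U\times N$. Define one-forms on $M$ by $$\theta_3=-\tfrac z2\,dt+\bigl(\cos(\tfrac12 t)\,H(x,y)+z\,l_2(x,y)\bigr)dx+\bigl(-\sin(\tfrac12 t)\,H(x,y)+z\,n_2(x,y)\bigr)dy,$$ $$\theta_4=dz-\sin(\tfrac12 t)\,H(x,y)\,dx-\cos(\tfrac12 t)\,H(x,y)\,dy,$$ and define the metric $g$ on $M$ by $$g(X,Y)=z^2g_\Sigma(X,Y)+\theta_3(X)\theta_3(Y)+\theta_4(X)\theta_4(Y).$$ Then: 1. $(M,g)$ admits a Kähler structure $\bar J$ with Kähler form $\bar\Omega=z^2\omega_\Sigma+\theta_4\wedge\theta_3$ and a Hermitian structure $J$ with Kähler form $\Omega=z^2\omega_\Sigma+\theta_3\wedge\theta_4$. 2. The Ricci tensor of $(M,g)$ is $J$-invariant, and $J$ is not locally conformally Kähler. 3. The Lee form of $(M,g,J)$ is $\theta=-\alpha\theta_4$, where $\alpha=-\frac2z$. 4. The scalar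 curvature of $(M,g)$ is $\tau=-\frac{2\Delta\ln h}{z^2h^2}-\frac{8}{z^2}$, and it is equal to the conformal scalar curvature $\kappa$ of $(M,g,J)$. 5. $(M,g,\bar J)$ is a semi-symmetric QCH Kähler surface.
   Context: Tensors on $U$ are pulled back to $M=U\times N$ by the projection, and $\Delta f=f_{xx}+f_{yy}$ is the flat Laplacian on $U$. An almost Hermitian structure on $(M,g)$ is an almost complex structure $J$ with $g(JX,JY)=g(X,Y)$. Its Kähler form is $\Omega(X,Y)=g(JX,Y)$. It is Hermitian if $J$ is integrable (vanishing Nijenhuis tensor), and Kähler if in addition $d\Omega=0$. The Lee form $\theta$ of a 4-dimensional Hermitian manifold $(M,g,J)$ is defined by $d\Omega=2\theta\wedge\Omega$. The structure $J$ is locally conformally Kähler if $d\theta=0$, i.e. $g$ is locally conformal to a metric which is Kähler with respect to $J$. The Ricci tensor $\rho$ is $J$-invariant if $\rho(JX,JY)=\rho(X,Y)$ for all vector fields $X,Y$. The scalar curvature is $\tau=\mathrm{tr}_g\rho$. The conformal scalar curvature of $(M,g,J)$ is $\kappa=\tau-6(|\theta|^2+\delta\theta)$, where $\delta$ is the codifferential (minus the divergence). The curvature tensor is $R(X,Y)Z=([\nabla_X,\nabla_Y]-\nabla_{[X,Y]})Z$ and $R(X,Y,Z,W)=g(R(X,Y)Z,W)$. A Riemannian manifold is semi-symmetric if $R\cdot R=0$, i.e. each endomorphism $R(X,Y)$, acting as a derivation on tensors, annihilates $R$. A QCH Kähler surface is a Kähler surface $(M,g,\bar J)$ (real dimension 4)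 with a $\bar J$-invariant 2-dimensional distribution $\mathcal D$ such that the holomorphic curvature $R(X,\bar JX,\bar JX,X)$, for unit $X\in T_xM$, depends only on the point $x$ and the number $|X_{\mathcal D}|=\sqrt{g(X_{\mathcal D},X_{\mathcal D})}$, where $X_{\mathcal D}$ is the orthogonal projection of $X$ onto $\mathcal D$. That is, $R(X,\bar JX,\bar JX,X)=\phi(x,|X_{\mathcal D}|)$ with $\phi(x,s)=a(x)+b(x)s^2+c(x)s^4$ and $a,b,c$ smooth functions on $M$. *)

theory Defs
  imports "HOL-Analysis.Analysis"
begin

text \<open>
  A manifold here is an open subset \<open>M\<close> of a Euclidean space \<open>'a\<close>, with every tangent space
  identified with \<open>'a\<close>. Tensor fields are functions of a base point followed by tangent vectors,
  defined on all of \<open>'a\<close> but constrained only on \<open>M\<close>. A tangent vector \<open>v\<close> at a point is extended,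
  whenever an extension is needed, to the constant vector field \<open>\<lambda>_. v\<close>; the Lie bracket of two
  constant fields vanishes.
\<close>

section \<open>Smoothness and directional derivatives\<close>

definition dird :: "('a::real_normed_vector \<Rightarrow> 'b::real_normed_vector) \<Rightarrow> 'a \<Rightarrow> 'a \<Rightarrow> 'b" where
  "dird f p v = frechet_derivative f (at p) v"

text \<open>These are meant for open \<open>S\<close>: derivatives are taken at points, not within \<open>S\<close>.\<close>

primrec Ck_on :: "nat \<Rightarrow> ('a::real_normed_vector \<Rightarrow> 'b::real_normed_vector) \<Rightarrow> 'a set \<Rightarrow> bool" where
  "Ck_on 0 f S \<longleftrightarrow> continuous_on S f"
| "Ck_on (Suc k) f S \<longleftrightarrow> (\<forall>p\<in>S. f differentiable (at p)) \<and> (\<forall>v. Ck_on k (\<lambda>p. dird f p v) S)"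

definition smooth_on :: "'a::real_normed_vector set \<Rightarrow> ('a \<Rightarrow> 'b::real_normed_vector) \<Rightarrow> bool" where
  "smooth_on S f \<longleftrightarrow> (\<forall>k. Ck_on k f S)"

definition d_x :: "(real \<times> real \<Rightarrow> real) \<Rightarrow> real \<times> real \<Rightarrow> real" where
  "d_x f q = dird f q (1, 0)"

definition d_y :: "(real \<times> real \<Rightarrow> real) \<Rightarrow> real \<times> real \<Rightarrow> real" where
  "d_y f q = dird f q (0, 1)"

definition flat_laplacian :: "(real \<times> real \<Rightarrow> real) \<Rightarrow> real \<times> real \<Rightarrow> real" where
  "flat_laplacian f q = d_x (d_x f) q + d_y (d_y f) q"

section \<open>Differential forms\<close>

type_synonym 'a form1 = "'a \<Rightarrow> 'a \<Rightarrow> real"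
type_synonym 'a form2 = "'a \<Rightarrow> 'a \<Rightarrow> 'a \<Rightarrow> real"
type_synonym 'a form3 = "'a \<Rightarrow> 'a \<Rightarrow> 'a \<Rightarrow> 'a \<Rightarrow> real"

definition one_form_on :: "'a::euclidean_space set \<Rightarrow> 'a form1 \<Rightarrow> bool" where
  "one_form_on M \<theta> \<longleftrightarrow> (\<forall>p\<in>M. linear (\<theta> p)) \<and> (\<forall>v. smooth_on M (\<lambda>p. \<theta> p v))"

text \<open>The wedge product is normalised by \<open>(\<alpha> \<and> \<beta>)(u, v) = \<alpha>(u) \<beta>(v) - \<alpha>(v) \<beta>(u)\<close>, so that
  \<open>dx \<and> dy\<close> takes the value \<open>1\<close> on the coordinate frame.\<close>

definition wedge11 :: "'a form1 \<Rightarrow> 'a form1 \<Rightarrow> 'a form2" where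
  "wedge11 \<alpha> \<beta> p u v = \<alpha> p u * \<beta> p v - \<alpha> p v * \<beta> p u"

definition wedge12 :: "'a form1 \<Rightarrow> 'a form2 \<Rightarrow> 'a form3" where
  "wedge12 \<theta> \<Omega> p u v w = \<theta> p u * \<Omega> p v w - \<theta> p v * \<Omega> p u w + \<theta> p w * \<Omega> p u v"

definition ext_d1 :: "'a::real_normed_vector form1 \<Rightarrow> 'a form2" where
  "ext_d1 \<theta> p u v = dird (\<lambda>q. \<theta> q v) p u - dird (\<lambda>q. \<theta> q u) p v"

definition ext_d2 :: "'a::real_normed_vector form2 \<Rightarrow> 'a form3" where
  "ext_d2 \<Omega> p u v w =
     dird (\<lambda>q. \<Omega> q v w) p u - dird (\<lambda>q. \<Omega> q u w) p v + dird (\<lambda>q. \<Omega> q u v) p w"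

section \<open>Riemannian metrics, the Levi-Civita connection and curvature\<close>

type_synonym 'a metric_tensor = "'a \<Rightarrow> 'a \<Rightarrow> 'a \<Rightarrow> real"
type_synonym 'a vfield = "'a \<Rightarrow> 'a"
type_synonym 'a endo = "'a \<Rightarrow> 'a \<Rightarrow> 'a"

definition riemannian_metric_on :: "'a::euclidean_space set \<Rightarrow> 'a metric_tensor \<Rightarrow> bool" where
  "riemannian_metric_on M g \<longleftrightarrow>
     (\<forall>p\<in>M. bilinear (g p) \<and> (\<forall>u v. g p u v = g p v u) \<and> (\<forall>v. v \<noteq> 0 \<longrightarrow> g p v v > 0)) \<and>
     (\<forall>u v. smooth_on M (\<lambda>p. g p u v))"

definition metric_norm :: "'a metric_tensor \<Rightarrow> 'a \<Rightarrow> 'a \<Rightarrow> real" where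
  "metric_norm g p v = sqrt (g p v v)"

text \<open>The tangent vector that is dual to a covector with respect to the metric.\<close>

definition sharp :: "'a metric_tensor \<Rightarrow> 'a \<Rightarrow> ('a \<Rightarrow> real) \<Rightarrow> 'a" where
  "sharp g p \<phi> = (THE w. \<forall>v. g p w v = \<phi> v)"

text \<open>The trace of a bilinear form \<open>B\<close> with respect to \<open>g\<close>. In the fixed basis \<open>Basis\<close> this is the
  sum of \<open>g^{ij} B_{ij}\<close>, because the vector dual to the covector \<open>(\<bullet>) b\<close> is obtained from \<open>b\<close> by
  the inverse of the Gram matrix.\<close>

definition metric_trace :: "'a::euclidean_space metric_tensor \<Rightarrow> 'a \<Rightarrow> ('a \<Rightarrow> 'a \<Rightarrow> real) \<Rightarrow> real" where
  "metric_trace g p B = (\<Sum>b\<in>Basis. B b (sharp g p (\<lambda>v. b \<bullet> v)))"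

definition lie_bracket :: "'a::real_normed_vector vfield \<Rightarrow> 'a vfield \<Rightarrow> 'a vfield" where
  "lie_bracket X Y p = dird Y p (X p) - dird X p (Y p)"

text \<open>The Levi-Civita connection, given by the Koszul formula:
  \<open>koszul g X Y Z = 2 g(\<nabla>\<^sub>X Y, Z)\<close>.\<close>

definition koszul ::
    "'a::real_normed_vector metric_tensor \<Rightarrow> 'a vfield \<Rightarrow> 'a vfield \<Rightarrow> 'a vfield \<Rightarrow> 'a \<Rightarrow> real" where
  "koszul g X Y Z p =
     dird (\<lambda>q. g q (Y q) (Z q)) p (X p)
     + dird (\<lambda>q. g q (X q) (Z q)) p (Y p)
     - dird (\<lambda>q. g q (X q) (Y q)) p (Z p)
     + g p (lie_bracket X Y p) (Z p)
     - g p (lie_bracket X Z p) (Y p)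
     - g p (lie_bracket Y Z p) (X p)"

definition levi_civita :: "'a::real_normed_vector metric_tensor \<Rightarrow> 'a vfield \<Rightarrow> 'a vfield \<Rightarrow> 'a vfield" where
  "levi_civita g X Y p = sharp g p (\<lambda>v. koszul g X Y (\<lambda>_. v) p / 2)"

definition curv_vf ::
    "'a::real_normed_vector metric_tensor \<Rightarrow> 'a vfield \<Rightarrow> 'a vfield \<Rightarrow> 'a vfield \<Rightarrow> 'a vfield" where
  "curv_vf g X Y Z p =
     levi_civita g X (levi_civita g Y Z) p - levi_civita g Y (levi_civita g X Z) p
     - levi_civita g (lie_bracket X Y) Z p"

text \<open>\<open>curv g p u v w\<close> is the vector \<open>R(u, v) w\<close> at \<open>p\<close>.\<close>

definition curv :: "'a::real_normed_vector metric_tensor \<Rightarrow> 'a \<Rightarrow> 'a \<Rightarrow> 'a \<Rightarrow> 'a \<Rightarrow> 'a" where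
  "curv g p u v w = curv_vf g (\<lambda>_. u) (\<lambda>_. v) (\<lambda>_. w) p"

definition curv4 :: "'a::real_normed_vector metric_tensor \<Rightarrow> 'a \<Rightarrow> 'a \<Rightarrow> 'a \<Rightarrow> 'a \<Rightarrow> 'a \<Rightarrow> real" where
  "curv4 g p u v w s = g p (curv g p u v w) s"

text \<open>\<open>ricci g p v w\<close> is the trace of the endomorphism \<open>u \<mapsto> R(u, v) w\<close>.\<close>

definition ricci :: "'a::euclidean_space metric_tensor \<Rightarrow> 'a \<Rightarrow> 'a \<Rightarrow> 'a \<Rightarrow> real" where
  "ricci g p v w = (\<Sum>b\<in>Basis. curv g p b v w \<bullet> b)"

definition scalar_curvature :: "'a::euclidean_space metric_tensor \<Rightarrow> 'a \<Rightarrow> real" where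
  "scalar_curvature g p = metric_trace g p (ricci g p)"

text \<open>\<open>(R(x, y) \<cdot> R)(u, v) w = 0\<close>, where the endomorphism \<open>R(x, y)\<close> acts as a derivation.\<close>

definition semi_symmetric_on :: "'a::euclidean_space set \<Rightarrow> 'a metric_tensor \<Rightarrow> bool" where
  "semi_symmetric_on M g \<longleftrightarrow>
     (\<forall>p\<in>M. \<forall>x y u v w.
        curv g p x y (curv g p u v w)
        - curv g p (curv g p x y u) v w
        - curv g p u (curv g p x y v) w
        - curv g p u v (curv g p x y w) = 0)"

text \<open>\<open>cov_d1 g \<theta> p u v\<close> is \<open>(\<nabla>\<^sub>u \<theta>)(v)\<close>.\<close>

definition cov_d1 :: "'a::real_normed_vector metric_tensor \<Rightarrow> 'a form1 \<Rightarrow> 'a \<Rightarrow> 'a \<Rightarrow> 'a \<Rightarrow> real" where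
  "cov_d1 g \<theta> p u v = dird (\<lambda>q. \<theta> q v) p u - \<theta> p (levi_civita g (\<lambda>_. u) (\<lambda>_. v) p)"

definition codiff1 :: "'a::euclidean_space metric_tensor \<Rightarrow> 'a form1 \<Rightarrow> 'a \<Rightarrow> real" where
  "codiff1 g \<theta> p = - metric_trace g p (cov_d1 g \<theta> p)"

definition form1_norm_sq :: "'a::euclidean_space metric_tensor \<Rightarrow> 'a form1 \<Rightarrow> 'a \<Rightarrow> real" where
  "form1_norm_sq g \<theta> p = metric_trace g p (\<lambda>u v. \<theta> p u * \<theta> p v)"

section \<open>Hermitian and Kaehler structures\<close>

definition almost_hermitian_on :: "'a::euclidean_space set \<Rightarrow> 'a metric_tensor \<Rightarrow> 'a endo \<Rightarrow> bool" where
  "almost_hermitian_on M g J \<longleftrightarrow>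
     riemannian_metric_on M g \<and>
     (\<forall>v. smooth_on M (\<lambda>p. J p v)) \<and>
     (\<forall>p\<in>M. linear (J p) \<and> (\<forall>v. J p (J p v) = - v) \<and> (\<forall>u v. g p (J p u) (J p v) = g p u v))"

definition kahler_form :: "'a metric_tensor \<Rightarrow> 'a endo \<Rightarrow> 'a form2" where
  "kahler_form g J p u v = g p (J p u) v"

definition nijenhuis :: "'a::real_normed_vector endo \<Rightarrow> 'a vfield \<Rightarrow> 'a vfield \<Rightarrow> 'a vfield" where
  "nijenhuis J X Y p =
     lie_bracket (\<lambda>q. J q (X q)) (\<lambda>q. J q (Y q)) p
     - J p (lie_bracket (\<lambda>q. J q (X q)) Y p)
     - J p (lie_bracket X (\<lambda>q. J q (Y q)) p)
     - lie_bracket X Y p"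

definition hermitian_on :: "'a::euclidean_space set \<Rightarrow> 'a metric_tensor \<Rightarrow> 'a endo \<Rightarrow> bool" where
  "hermitian_on M g J \<longleftrightarrow>
     almost_hermitian_on M g J \<and>
     (\<forall>X Y. smooth_on M X \<longrightarrow> smooth_on M Y \<longrightarrow> (\<forall>p\<in>M. nijenhuis J X Y p = 0))"

definition kahler_on :: "'a::euclidean_space set \<Rightarrow> 'a metric_tensor \<Rightarrow> 'a endo \<Rightarrow> bool" where
  "kahler_on M g J \<longleftrightarrow>
     hermitian_on M g J \<and> (\<forall>p\<in>M. \<forall>u v w. ext_d2 (kahler_form g J) p u v w = 0)"

text \<open>In real dimension 4 there is at most one such form on \<open>M\<close>.\<close>

definition is_lee_form_on ::
    "'a::euclidean_space set \<Rightarrow> 'a metric_tensor \<Rightarrow> 'a endo \<Rightarrow> 'a form1 \<Rightarrow> bool" where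
  "is_lee_form_on M g J \<theta> \<longleftrightarrow>
     one_form_on M \<theta> \<and>
     (\<forall>p\<in>M. \<forall>u v w. ext_d2 (kahler_form g J) p u v w = 2 * wedge12 \<theta> (kahler_form g J) p u v w)"

definition locally_conformally_kahler_on ::
    "'a::euclidean_space set \<Rightarrow> 'a metric_tensor \<Rightarrow> 'a endo \<Rightarrow> bool" where
  "locally_conformally_kahler_on M g J \<longleftrightarrow>
     hermitian_on M g J \<and>
     (\<exists>\<theta>. is_lee_form_on M g J \<theta> \<and> (\<forall>p\<in>M. \<forall>u v. ext_d1 \<theta> p u v = 0))"

text \<open>The second argument is meant to be the Lee form.\<close>

definition conformal_scalar_curvature :: "'a::euclidean_space metric_tensor \<Rightarrow> 'a form1 \<Rightarrow> 'a \<Rightarrow> real" where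
  "conformal_scalar_curvature g \<theta> p =
     scalar_curvature g p - 6 * (form1_norm_sq g \<theta> p + codiff1 g \<theta> p)"

definition ricci_invariant_on :: "'a::euclidean_space set \<Rightarrow> 'a metric_tensor \<Rightarrow> 'a endo \<Rightarrow> bool" where
  "ricci_invariant_on M g J \<longleftrightarrow> (\<forall>p\<in>M. \<forall>u v. ricci g p (J p u) (J p v) = ricci g p u v)"

section \<open>QCH Kaehler surfaces\<close>

definition distribution2_on :: "'a::euclidean_space set \<Rightarrow> ('a \<Rightarrow> 'a set) \<Rightarrow> bool" where
  "distribution2_on M D \<longleftrightarrow>
     (\<forall>p\<in>M. subspace (D p) \<and> dim (D p) = 2) \<and>
     (\<forall>p\<in>M. \<exists>V X Y. open V \<and> p \<in> V \<and> V \<subseteq> M \<and> smooth_on V X \<and> smooth_on V Y \<and>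
        (\<forall>q\<in>V. D q = span {X q, Y q}))"

definition orth_proj :: "'a::real_vector metric_tensor \<Rightarrow> 'a \<Rightarrow> 'a set \<Rightarrow> 'a \<Rightarrow> 'a" where
  "orth_proj g p W v = (THE w. w \<in> W \<and> (\<forall>u\<in>W. g p (v - w) u = 0))"

definition qch_kahler_surface_on :: "'a::euclidean_space set \<Rightarrow> 'a metric_tensor \<Rightarrow> 'a endo \<Rightarrow> bool" where
  "qch_kahler_surface_on M g J \<longleftrightarrow>
     DIM('a) = 4 \<and> kahler_on M g J \<and>
     (\<exists>D. distribution2_on M D \<and> (\<forall>p\<in>M. J p ` D p \<subseteq> D p) \<and>
       (\<exists>a b c. smooth_on M a \<and> smooth_on M b \<and> smooth_on M c \<and>
         (\<forall>p\<in>M. \<forall>v. metric_norm g p v = 1 \<longrightarrow>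
            (let s = metric_norm g p (orth_proj g p (D p) v) in
             curv4 g p v (J p v) (J p v) v = a p + b p * s ^ 2 + c p * s ^ 4))))"

end

theory Submission
  imports Defs
begin

text \<open>
  Everything follows from Cartan's structure equations for one coframe. With
  \<open>A + iB = H e^{it/2} (dx + i dy)\<close> and \<open>\<psi> = l\<^sub>2 dx + n\<^sub>2 dy - dt/2\<close>, the forms
  \<open>\<theta>\<^sub>1 = z h dx\<close>, \<open>\<theta>\<^sub>2 = z h dy\<close>, \<open>\<theta>\<^sub>3 = A + z \<psi>\<close>, \<open>\<theta>\<^sub>4 = dz - B\<close> are orthonormal. The functions
  \<open>l\<^sub>2\<close> and \<open>n\<^sub>2\<close> are such that \<open>d(A + iB) = -i \<psi> \<and> (A + iB)\<close>, and the equation for \<open>\<Delta> ln H\<close>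
  says that \<open>d\<psi> = 2 h\<^sup>2 dx \<and> dy\<close>. Hence, with \<open>\<sigma>\<close> the connection form of \<open>g\<^sub>\<Sigma>\<close>,
  the skew forms \<open>\<omega>\<^sub>1\<^sub>2 = \<sigma> - \<psi>\<close>, \<open>\<omega>\<^sub>3\<^sub>4 = \<psi>\<close>, \<open>\<omega>\<^sub>1\<^sub>4 = \<omega>\<^sub>2\<^sub>3 = h dx\<close>, \<open>\<omega>\<^sub>2\<^sub>4 = - \<omega>\<^sub>1\<^sub>3 = h dy\<close> satisfy
  \<open>d\<theta>\<^sub>i = - \<Sum>\<^sub>j \<omega>\<^sub>i\<^sub>j \<and> \<theta>\<^sub>j\<close>, so they are the Levi-Civita connection (\<open>ext_d1_theta\<close>,
  \<open>form_levi_civita\<close>).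

  All but one of the curvature forms \<open>d\<omega>\<^sub>i\<^sub>j + \<Sum>\<^sub>k \<omega>\<^sub>i\<^sub>k \<and> \<omega>\<^sub>k\<^sub>j\<close> (\<open>i < j\<close>) cancel; the
  remaining one is \<open>K \<theta>\<^sub>1 \<and> \<theta>\<^sub>2\<close> with \<open>K = - \<Delta> ln h / (z\<^sup>2 h\<^sup>2) - 4 / z\<^sup>2\<close> (\<open>planar_curv_form\<close>).
  The curvature operator therefore lives in the single plane \<open>\<D>\<close> spanned by \<open>E\<^sub>1\<close> and \<open>E\<^sub>2\<close>. This gives
  the Ricci tensor \<open>K (\<theta>\<^sub>1\<^sup>2 + \<theta>\<^sub>2\<^sup>2)\<close>, the scalar curvature \<open>2K\<close>, semi-symmetry, because all
  \<open>R(u, v)\<close> are multiples of one quarter turn of the plane, whose derivation action annihilates the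
  area form of the plane, and the holomorphic curvature \<open>K s\<^sup>4\<close>,
  where \<open>s\<close> is the length of the projection to \<open>\<D>\<close> (locale \<open>planar_curvature\<close>).

  The two complex structures are \<open>E\<^sub>1 \<mapsto> E\<^sub>2\<close>, \<open>E\<^sub>3 \<mapsto> \<epsilon> E\<^sub>4\<close> with \<open>\<epsilon> = 1\<close> for \<open>J\<close> and \<open>\<epsilon> = -1\<close> for the
  Kaehler one. Having constant coefficients in the frame, their Nijenhuis tensors are algebraic
  in the \<open>d\<theta>\<^sub>i\<close> (\<open>nijenhuis_form\<close>), and the structure equations make them vanish. They also give
  \<open>d\<Omega> = (2/z) (1 + \<epsilon>) \<theta>\<^sub>4 \<and> \<Omega>\<close>: zero for \<open>\<epsilon> = -1\<close>, and for \<open>\<epsilon> = 1\<close> the Lee form \<open>(2/z) \<theta>\<^sub>4\<close>,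
  which is not closed and satisfies \<open>|\<theta>|\<^sup>2 + \<delta>\<theta> = 4/z\<^sup>2 - 4/z\<^sup>2 = 0\<close>.
\<close>

section \<open>Directional derivatives and smooth functions\<close>

lemma dird_eqI: "(f has_derivative f') (at p) \<Longrightarrow> dird f p v = f' v"
  unfolding dird_def by (metis frechet_derivative_at)

lemma has_derivative_dird:
  "f differentiable (at p) \<Longrightarrow> (f has_derivative dird f p) (at p)"
  unfolding dird_def[abs_def] by (simp add: frechet_derivative_works)

lemma dird_cong_open:
  assumes "open S" "p \<in> S" "\<And>q. q \<in> S \<Longrightarrow> f q = g q"
  shows "dird f p v = dird g p v"
proof -
  have "(f has_derivative D) (at p) \<longleftrightarrow> (g has_derivative D) (at p)" for D
    using has_derivative_transform_within_open[of f D p UNIV S g]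
      has_derivative_transform_within_open[of g D p UNIV S f] assms by auto
  then show ?thesis
    unfolding dird_def frechet_derivative_def by presburger
qed

lemma differentiable_cong_open:
  assumes "f differentiable (at p)" "open S" "p \<in> S" "\<And>q. q \<in> S \<Longrightarrow> f q = g q"
  shows "g differentiable (at p)"
  using assms has_derivative_transform_within_open[of f _ p UNIV S g]
  unfolding differentiable_def by blast

lemma Ck_on_cong:
  assumes "open S" "\<And>q. q \<in> S \<Longrightarrow> f q = g q" "Ck_on k f S"
  shows "Ck_on k g S"
  using assms(2,3)
proof (induction k arbitrary: f g)
  case 0
  then show ?case by (auto intro: continuous_on_eq)
next
  case (Suc k)
  have "Ck_on k (\<lambda>p. dird g p v) S" for v
    using Suc.IH[of "\<lambda>p. dird f p v" "\<lambda>p. dird g p v"] Suc.prems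
      dird_cong_open[OF assms(1), of _ f g v] by auto
  with Suc.prems differentiable_cong_open[OF _ assms(1), of f _ g] show ?case by auto
qed

text \<open>The recursion of \<open>Ck_on\<close> asks for continuity only of the last derivatives, so this needs an
  induction that starts from continuity of differentiable functions.\<close>

lemma Ck_on_Suc_D: "Ck_on (Suc k) f S \<Longrightarrow> Ck_on k f S"
proof (induction k arbitrary: f)
  case 0
  then show ?case
    by (auto intro!: continuous_at_imp_continuous_on differentiable_imp_continuous_within)
next
  case (Suc k)
  then show ?case by (metis Ck_on.simps(2))
qed

text \<open>With this rule each closure property below is an induction on the order in which it only
  remains to name the derivative.\<close>

lemma Ck_on_SucI:
  assumes "open S" "\<And>p. p \<in> S \<Longrightarrow> (f has_derivative D p) (at p)"
    "\<And>v. Ck_on k (\<lambda>p. D p v) S"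
  shows "Ck_on (Suc k) f S"
proof -
  have "Ck_on k (\<lambda>p. dird f p v) S" for v
    by (rule Ck_on_cong[OF assms(1) _ assms(3)]) (simp add: dird_eqI[OF assms(2)])
  then show ?thesis using assms(2) by (auto simp: differentiable_def)
qed

lemma Ck_on_const: "Ck_on k (\<lambda>p. c) S"
proof (induction k arbitrary: c)
  case (Suc k)
  have "dird (\<lambda>p. c) p v = 0" for p v :: 'a by (rule dird_eqI) simp
  with Suc show ?case by simp
qed simp

lemma Ck_on_linear:
  assumes "open S" "bounded_linear L"
  shows "Ck_on k L S"
proof (cases k)
  case 0 with assms show ?thesis by (simp add: linear_continuous_on)
next
  case (Suc j)
  show ?thesis unfolding Suc
    by (rule Ck_on_SucI[OF assms(1) bounded_linear_imp_has_derivative[OF assms(2)] Ck_on_const])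
qed

lemma Ck_on_linear_image:
  assumes "open S" "bounded_linear L" "Ck_on k f S"
  shows "Ck_on k (\<lambda>p. L (f p)) S"
  using assms(3)
proof (induction k arbitrary: f)
  case 0 with assms(2) show ?case
    by (simp add: bounded_linear.continuous_on)
next
  case (Suc k)
  then show ?case
    by (intro Ck_on_SucI[OF assms(1), where D="\<lambda>p v. L (dird f p v)"])
      (auto intro: bounded_linear.has_derivative[OF assms(2)] has_derivative_dird)
qed

lemma Ck_on_linear_preimage:
  assumes "open S" "bounded_linear L" "L ` S \<subseteq> T" "Ck_on k f T"
  shows "Ck_on k (\<lambda>p. f (L p)) S"
  using assms(4)
proof (induction k arbitrary: f)
  case 0 with assms(2,3) show ?case
    by (simp add: continuous_on_compose2[OF _ linear_continuous_on])
next
  case (Suc k)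
  show ?case
  proof (intro Ck_on_SucI[OF assms(1), where D="\<lambda>p v. dird f (L p) (L v)"])
    show "((\<lambda>p. f (L p)) has_derivative (\<lambda>v. dird f (L p) (L v))) (at p)" if "p \<in> S" for p
      using Suc.prems that assms(3)
      by (intro has_derivative_compose[OF bounded_linear_imp_has_derivative[OF assms(2)]]
          has_derivative_dird) auto
  qed (use Suc in auto)
qed

lemma Ck_on_add:
  assumes "open S" "Ck_on k f S" "Ck_on k g S"
  shows "Ck_on k (\<lambda>p. f p + g p) S"
  using assms(2,3)
proof (induction k arbitrary: f g)
  case (Suc k)
  then show ?case
    by (intro Ck_on_SucI[OF assms(1), where D="\<lambda>p v. dird f p v + dird g p v"])
      (auto intro!: has_derivative_add has_derivative_dird)
qed (auto intro: continuous_intros)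

lemma Ck_on_bilinear:
  assumes "open S" "bounded_bilinear B" "Ck_on k f S" "Ck_on k g S"
  shows "Ck_on k (\<lambda>p. B (f p) (g p)) S"
  using assms(3,4)
proof (induction k arbitrary: f g)
  case 0 then show ?case by (simp add: bounded_bilinear.continuous_on[OF assms(2)])
next
  case (Suc k)
  have "Ck_on k f S" "Ck_on k g S" using Suc.prems Ck_on_Suc_D by blast+
  with Suc show ?case
    by (intro Ck_on_SucI[OF assms(1),
          where D="\<lambda>p v. B (f p) (dird g p v) + B (dird f p v) (g p)"])
      (auto intro!: bounded_bilinear.FDERIV[OF assms(2)] has_derivative_dird Ck_on_add[OF assms(1)])
qed

lemma Ck_on_inverse:
  fixes f :: "'a::real_normed_vector \<Rightarrow> real"
  assumes "open S" "\<And>p. p \<in> S \<Longrightarrow> f p \<noteq> 0" "Ck_on k f S"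
  shows "Ck_on k (\<lambda>p. inverse (f p)) S"
  using assms(3)
proof (induction k)
  case 0 with assms(2) show ?case by (auto intro: continuous_intros)
next
  case (Suc k)
  note B = Ck_on_bilinear[OF assms(1) bounded_bilinear_mult]
  have "Ck_on k (\<lambda>p. - (inverse (f p) * dird f p v * inverse (f p))) S" for v
    using Suc Ck_on_Suc_D[OF Suc.prems]
    by (intro Ck_on_linear_image[OF assms(1) bounded_linear_minus[OF bounded_linear_ident]] B) auto
  moreover have "((\<lambda>p. inverse (f p)) has_derivative
      (\<lambda>v. - (inverse (f p) * dird f p v * inverse (f p)))) (at p)" if "p \<in> S" for p
    using Suc.prems that assms(2) by (intro Deriv.has_derivative_inverse has_derivative_dird) auto
  ultimately show ?case by (intro Ck_on_SucI[OF assms(1)])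
qed

text \<open>The two functions are treated together since each is, up to sign, the derivative of the
  other.\<close>

lemma Ck_on_sin_cos:
  fixes f :: "'a::real_normed_vector \<Rightarrow> real"
  assumes "open S" "Ck_on k f S"
  shows "Ck_on k (\<lambda>p. sin (f p)) S \<and> Ck_on k (\<lambda>p. cos (f p)) S"
  using assms(2)
proof (induction k)
  case 0 then show ?case by (auto intro: continuous_intros)
next
  case (Suc k)
  note B = Ck_on_bilinear[OF assms(1) bounded_bilinear_mult]
  note minus = Ck_on_linear_image[OF assms(1) bounded_linear_minus[OF bounded_linear_ident]]
  have IH: "Ck_on k (\<lambda>p. sin (f p)) S" "Ck_on k (\<lambda>p. cos (f p)) S"
    using Suc Ck_on_Suc_D by blast+
  have f: "(f has_derivative dird f p) (at p)" if "p \<in> S" for p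
    using Suc.prems that by (simp add: has_derivative_dird)
  have f': "Ck_on k (\<lambda>p. dird f p v) S" for v using Suc.prems by simp
  show ?case
    by (intro conjI Ck_on_SucI[OF assms(1) has_derivative_sin[OF f]]
        Ck_on_SucI[OF assms(1) has_derivative_cos[OF f]] B minus f' IH)
qed

lemma smooth_on_cong:
  "open S \<Longrightarrow> (\<And>q. q \<in> S \<Longrightarrow> f q = g q) \<Longrightarrow> smooth_on S f \<Longrightarrow> smooth_on S g"
  unfolding smooth_on_def by (blast intro: Ck_on_cong)

lemma smooth_on_differentiable: "smooth_on S f \<Longrightarrow> p \<in> S \<Longrightarrow> f differentiable (at p)"
  unfolding smooth_on_def using Ck_on.simps(2) by blast

lemma smooth_on_dird: "smooth_on S f \<Longrightarrow> smooth_on S (\<lambda>p. dird f p v)"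
  unfolding smooth_on_def using Ck_on.simps(2) by blast

lemma smooth_on_linear: "open S \<Longrightarrow> bounded_linear L \<Longrightarrow> smooth_on S L"
  unfolding smooth_on_def by (blast intro: Ck_on_linear)

lemma smooth_on_linear_image:
  "open S \<Longrightarrow> bounded_linear L \<Longrightarrow> smooth_on S f \<Longrightarrow> smooth_on S (\<lambda>p. L (f p))"
  unfolding smooth_on_def by (blast intro: Ck_on_linear_image)

lemma smooth_on_linear_preimage:
  "open S \<Longrightarrow> bounded_linear L \<Longrightarrow> L ` S \<subseteq> T \<Longrightarrow> smooth_on T f \<Longrightarrow> smooth_on S (\<lambda>p. f (L p))"
  unfolding smooth_on_def by (blast intro: Ck_on_linear_preimage)

lemma smooth_on_const: "smooth_on S (\<lambda>p. c)"
  unfolding smooth_on_def by (blast intro: Ck_on_const)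

lemma smooth_on_add:
  "open S \<Longrightarrow> smooth_on S f \<Longrightarrow> smooth_on S g \<Longrightarrow> smooth_on S (\<lambda>p. f p + g p)"
  unfolding smooth_on_def by (blast intro: Ck_on_add)

lemma smooth_on_bilinear:
  "open S \<Longrightarrow> bounded_bilinear B \<Longrightarrow> smooth_on S f \<Longrightarrow> smooth_on S g \<Longrightarrow>
    smooth_on S (\<lambda>p. B (f p) (g p))"
  unfolding smooth_on_def by (blast intro: Ck_on_bilinear)

lemma smooth_on_mult:
  fixes f g :: "'a::real_normed_vector \<Rightarrow> real"
  shows "open S \<Longrightarrow> smooth_on S f \<Longrightarrow> smooth_on S g \<Longrightarrow> smooth_on S (\<lambda>p. f p * g p)"
  by (rule smooth_on_bilinear[OF _ bounded_bilinear_mult])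

lemma smooth_on_scaleR:
  "open S \<Longrightarrow> smooth_on S f \<Longrightarrow> smooth_on S g \<Longrightarrow> smooth_on S (\<lambda>p. f p *\<^sub>R g p)"
  by (rule smooth_on_bilinear[OF _ bounded_bilinear_scaleR])

lemma smooth_on_minus: "open S \<Longrightarrow> smooth_on S f \<Longrightarrow> smooth_on S (\<lambda>p. - f p)"
  by (rule smooth_on_linear_image[OF _ bounded_linear_minus[OF bounded_linear_ident]])

lemma smooth_on_diff:
  "open S \<Longrightarrow> smooth_on S f \<Longrightarrow> smooth_on S g \<Longrightarrow> smooth_on S (\<lambda>p. f p - g p)"
  using smooth_on_add[of S f "\<lambda>p. - g p"] smooth_on_minus[of S g] by simp

lemma smooth_on_sum:
  assumes "open S" "\<And>i. i \<in> I \<Longrightarrow> smooth_on S (f i)"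
  shows "smooth_on S (\<lambda>p. \<Sum>i\<in>I. f i p)"
  using assms(2)
  by (induction I rule: infinite_finite_induct)
    (simp_all add: smooth_on_const smooth_on_add[OF assms(1)])

lemma smooth_on_power:
  fixes f :: "'a::real_normed_vector \<Rightarrow> real"
  shows "open S \<Longrightarrow> smooth_on S f \<Longrightarrow> smooth_on S (\<lambda>p. f p ^ n)"
  by (induction n) (simp_all add: smooth_on_const smooth_on_mult)

lemma smooth_on_Pair:
  assumes "open S" "smooth_on S f" "smooth_on S g"
  shows "smooth_on S (\<lambda>p. (f p, g p))"
proof -
  have "smooth_on S (\<lambda>p. (f p, 0) + (0, g p))"
    by (intro smooth_on_add smooth_on_linear_image[of S "\<lambda>v. (v, 0)"]
        smooth_on_linear_image[of S "\<lambda>v. (0, v)"] bounded_linear_Pair bounded_linear_ident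
        bounded_linear_zero assms)
  then show ?thesis by simp
qed

lemma smooth_on_inverse:
  fixes f :: "'a::real_normed_vector \<Rightarrow> real"
  shows "open S \<Longrightarrow> (\<And>p. p \<in> S \<Longrightarrow> f p \<noteq> 0) \<Longrightarrow> smooth_on S f \<Longrightarrow> smooth_on S (\<lambda>p. inverse (f p))"
  unfolding smooth_on_def by (blast intro: Ck_on_inverse)

lemma smooth_on_divide:
  fixes f g :: "'a::real_normed_vector \<Rightarrow> real"
  shows "open S \<Longrightarrow> (\<And>p. p \<in> S \<Longrightarrow> g p \<noteq> 0) \<Longrightarrow> smooth_on S f \<Longrightarrow> smooth_on S g \<Longrightarrow>
    smooth_on S (\<lambda>p. f p / g p)"
  unfolding divide_inverse by (intro smooth_on_mult smooth_on_inverse)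

lemma smooth_on_sin:
  fixes f :: "'a::real_normed_vector \<Rightarrow> real"
  shows "open S \<Longrightarrow> smooth_on S f \<Longrightarrow> smooth_on S (\<lambda>p. sin (f p))"
  unfolding smooth_on_def using Ck_on_sin_cos by blast

lemma smooth_on_cos:
  fixes f :: "'a::real_normed_vector \<Rightarrow> real"
  shows "open S \<Longrightarrow> smooth_on S f \<Longrightarrow> smooth_on S (\<lambda>p. cos (f p))"
  unfolding smooth_on_def using Ck_on_sin_cos by blast

lemma has_derivative_ln_dird:
  fixes f :: "'a::real_normed_vector \<Rightarrow> real"
  assumes "f differentiable (at p)" "f p > 0"
  shows "((\<lambda>p. ln (f p)) has_derivative (\<lambda>v. dird f p v * inverse (f p))) (at p)"
  using assms by (auto intro!: has_derivative_ln has_derivative_dird)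

lemma smooth_on_ln:
  fixes f :: "'a::real_normed_vector \<Rightarrow> real"
  assumes "open S" "\<And>p. p \<in> S \<Longrightarrow> f p > 0" "smooth_on S f"
  shows "smooth_on S (\<lambda>p. ln (f p))"
  unfolding smooth_on_def
proof
  fix k
  have "smooth_on S (\<lambda>p. dird f p v * inverse (f p))" for v
    using assms
    by (intro smooth_on_mult smooth_on_inverse smooth_on_dird) (auto simp: less_imp_neq[symmetric])
  then have "Ck_on (Suc k) (\<lambda>p. ln (f p)) S"
    by (intro Ck_on_SucI[OF assms(1) has_derivative_ln_dird[OF
            smooth_on_differentiable[OF assms(3)] assms(2)]]) (simp_all add: smooth_on_def)
  then show "Ck_on k (\<lambda>p. ln (f p)) S" by (rule Ck_on_Suc_D)
qed

lemmas smooth_intros =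
  smooth_on_const smooth_on_add smooth_on_mult smooth_on_scaleR smooth_on_minus smooth_on_diff
  smooth_on_sum smooth_on_power smooth_on_Pair smooth_on_divide smooth_on_sin smooth_on_cos
  smooth_on_ln smooth_on_dird

section \<open>Symmetry of second derivatives\<close>

lemma DERIV_along_line:
  fixes f :: "'a::real_normed_vector \<Rightarrow> real"
  assumes "f differentiable (at (q + s *\<^sub>R u))"
  shows "DERIV (\<lambda>s. f (q + s *\<^sub>R u)) s :> dird f (q + s *\<^sub>R u) u"
proof -
  interpret D: bounded_linear "dird f (q + s *\<^sub>R u)"
    using has_derivative_dird[OF assms] by (rule has_derivative_bounded_linear)
  have "((\<lambda>s. q + s *\<^sub>R u) has_derivative (\<lambda>h. h *\<^sub>R u)) (at s)"
    by (auto intro!: derivative_eq_intros)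
  from has_derivative_compose[OF this has_derivative_dird[OF assms]]
  show ?thesis by (simp add: has_field_derivative_def D.scaleR mult_commute_abs)
qed

text \<open>Two applications of the mean value theorem, first in the direction \<open>u\<close> and then in the
  direction \<open>v\<close>. The left-hand side is symmetric in \<open>u\<close> and \<open>v\<close>, which is what makes mixed second
  derivatives agree.\<close>

lemma second_difference_mean_value:
  fixes f :: "'a::real_normed_vector \<Rightarrow> real"
  assumes "smooth_on S f" "0 < h"
    and sub: "\<And>s t. \<lbrakk>0 \<le> s; s \<le> h; 0 \<le> t; t \<le> h\<rbrakk> \<Longrightarrow> p + s *\<^sub>R u + t *\<^sub>R v \<in> S"
  shows "\<exists>s t. 0 \<le> s \<and> s \<le> h \<and> 0 \<le> t \<and> t \<le> h \<and>
    f (p + h *\<^sub>R u + h *\<^sub>R v) - f (p + h *\<^sub>R u) - f (p + h *\<^sub>R v) + f p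
      = h * h * dird (\<lambda>q. dird f q u) (p + s *\<^sub>R u + t *\<^sub>R v) v"
proof -
  have diff: "f differentiable (at (p + s *\<^sub>R u + t *\<^sub>R v))"
    "(\<lambda>q. dird f q u) differentiable (at (p + s *\<^sub>R u + t *\<^sub>R v))"
    if "0 \<le> s" "s \<le> h" "0 \<le> t" "t \<le> h" for s t
    using smooth_on_differentiable[OF _ sub[OF that]] smooth_on_dird assms(1) by blast+
  let ?G = "\<lambda>s. f (p + h *\<^sub>R v + s *\<^sub>R u) - f (p + s *\<^sub>R u)"
  have "DERIV ?G s :> dird f (p + h *\<^sub>R v + s *\<^sub>R u) u - dird f (p + s *\<^sub>R u) u"
    if "0 \<le> s" "s \<le> h" for s
    using diff(1)[of s h] diff(1)[of s 0] that assms(2)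
    by (intro DERIV_diff DERIV_along_line) (simp_all add: ac_simps)
  from MVT2[OF assms(2) this] obtain s where s: "0 < s" "s < h"
    and "?G h - ?G 0 = (h - 0) * (dird f (p + h *\<^sub>R v + s *\<^sub>R u) u - dird f (p + s *\<^sub>R u) u)"
    by blast
  then have 1: "f (p + h *\<^sub>R u + h *\<^sub>R v) - f (p + h *\<^sub>R u) - f (p + h *\<^sub>R v) + f p
      = h * (dird f (p + s *\<^sub>R u + h *\<^sub>R v) u - dird f (p + s *\<^sub>R u) u)"
    by (simp add: algebra_simps)
  have "DERIV (\<lambda>t. dird f (p + s *\<^sub>R u + t *\<^sub>R v) u) t
      :> dird (\<lambda>q. dird f q u) (p + s *\<^sub>R u + t *\<^sub>R v) v" if "0 \<le> t" "t \<le> h" for t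
    using diff(2)[of s t] that s by (intro DERIV_along_line) simp
  from MVT2[OF assms(2) this] obtain t where "0 < t" "t < h"
    and "dird f (p + s *\<^sub>R u + h *\<^sub>R v) u - dird f (p + s *\<^sub>R u + 0 *\<^sub>R v) u
      = (h - 0) * dird (\<lambda>q. dird f q u) (p + s *\<^sub>R u + t *\<^sub>R v) v"
    by blast
  with 1 s show ?thesis by (intro exI[of _ s] exI[of _ t]) simp
qed

text \<open>Were the two values different, the second difference over a small parallelogram at \<open>p\<close>,
  divided by the square of its size, would be close to both of them by continuity.\<close>

lemma dird_dird_commute:
  fixes f :: "'a::real_normed_vector \<Rightarrow> real"
  assumes "open S" "smooth_on S f" "p \<in> S"
  shows "dird (\<lambda>q. dird f q u) p v = dird (\<lambda>q. dird f q v) p u"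
proof (rule ccontr)
  let ?A = "\<lambda>q. dird (\<lambda>q. dird f q u) q v" and ?B = "\<lambda>q. dird (\<lambda>q. dird f q v) q u"
  assume "?A p \<noteq> ?B p"
  define e where "e = \<bar>?A p - ?B p\<bar> / 2"
  have "e > 0" using \<open>?A p \<noteq> ?B p\<close> by (simp add: e_def)
  have "isCont ?A p" "isCont ?B p"
    by (intro differentiable_imp_continuous_within
        smooth_on_differentiable[OF smooth_on_dird[OF smooth_on_dird[OF assms(2)]] assms(3)])+
  then obtain r1 r2 where r: "r1 > 0" "\<And>q. dist q p < r1 \<Longrightarrow> \<bar>?A q - ?A p\<bar> < e"
      "r2 > 0" "\<And>q. dist q p < r2 \<Longrightarrow> \<bar>?B q - ?B p\<bar> < e"
    unfolding continuous_at_eps_delta using \<open>e > 0\<close> by (metis dist_real_def)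
  obtain r3 where "r3 > 0" and r3: "\<And>q. dist q p < r3 \<Longrightarrow> q \<in> S"
    using assms(1,3) unfolding open_dist by blast
  define r where "r = min r1 (min r2 r3)"
  \<comment> \<open>the parallelogram spanned by \<open>h u\<close> and \<open>h v\<close> at \<open>p\<close> then lies in the ball of radius \<open>r\<close>\<close>
  define h where "h = r / (norm u + norm v + 1)"
  have "r > 0" using r \<open>r3 > 0\<close> by (simp add: r_def)
  have "norm u + norm v + 1 > 0" by (simp add: add_nonneg_pos)
  then have "h > 0" using \<open>r > 0\<close> by (simp add: h_def)
  have near: "dist (p + s *\<^sub>R u + t *\<^sub>R v) p < r"
    if "0 \<le> s" "s \<le> h" "0 \<le> t" "t \<le> h" for s t
  proof -
    have "dist (p + s *\<^sub>R u + t *\<^sub>R v) p \<le> s * norm u + t * norm v"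
      using norm_triangle_ineq[of "s *\<^sub>R u" "t *\<^sub>R v"] that by (simp add: dist_norm add.assoc)
    also have "\<dots> \<le> h * norm u + h * norm v" using that by (intro add_mono mult_right_mono) auto
    also have "\<dots> = h * (norm u + norm v)" by (simp add: distrib_left)
    also have "\<dots> < h * (norm u + norm v + 1)" using \<open>h > 0\<close> by simp
    also have "\<dots> = r" using \<open>norm u + norm v + 1 > 0\<close> by (simp add: h_def)
    finally show ?thesis .
  qed
  have sub: "p + s *\<^sub>R u + t *\<^sub>R v \<in> S" if "0 \<le> s" "s \<le> h" "0 \<le> t" "t \<le> h" for s t
    using near[OF that] r3 by (simp add: r_def)
  from second_difference_mean_value[OF assms(2) \<open>h > 0\<close> sub] obtain s t
    where st: "0 \<le> s" "s \<le> h" "0 \<le> t" "t \<le> h"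
      and A: "f (p + h *\<^sub>R u + h *\<^sub>R v) - f (p + h *\<^sub>R u) - f (p + h *\<^sub>R v) + f p
        = h * h * ?A (p + s *\<^sub>R u + t *\<^sub>R v)" by blast
  have sub': "p + t *\<^sub>R v + s *\<^sub>R u \<in> S" if "0 \<le> t" "t \<le> h" "0 \<le> s" "s \<le> h" for s t
    using sub[of s t] that by (simp add: ac_simps)
  from second_difference_mean_value[OF assms(2) \<open>h > 0\<close> sub'] obtain s' t'
    where st': "0 \<le> s'" "s' \<le> h" "0 \<le> t'" "t' \<le> h"
      and B: "f (p + h *\<^sub>R v + h *\<^sub>R u) - f (p + h *\<^sub>R v) - f (p + h *\<^sub>R u) + f p
        = h * h * ?B (p + s' *\<^sub>R v + t' *\<^sub>R u)" by blast
  have "?A (p + s *\<^sub>R u + t *\<^sub>R v) = ?B (p + t' *\<^sub>R u + s' *\<^sub>R v)"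
  proof -
    have "h * h * ?A (p + s *\<^sub>R u + t *\<^sub>R v) = h * h * ?B (p + s' *\<^sub>R v + t' *\<^sub>R u)"
      unfolding A[symmetric] B[symmetric]
      by (simp add: add.assoc add.commute[of "h *\<^sub>R u" "h *\<^sub>R v"])
    with \<open>h > 0\<close> show ?thesis
      by (simp add: add.assoc add.commute[of "s' *\<^sub>R v" "t' *\<^sub>R u"])
  qed
  moreover have False if "a = b" "\<bar>a - c\<bar> < e" "\<bar>b - d\<bar> < e" "e = \<bar>c - d\<bar> / 2"
    for a b c d :: real using that by (auto simp: abs_if split: if_splits)
  moreover have "\<bar>?A (p + s *\<^sub>R u + t *\<^sub>R v) - ?A p\<bar> < e"
    using near[OF st] by (intro r(2)) (simp add: r_def)
  moreover have "\<bar>?B (p + t' *\<^sub>R u + s' *\<^sub>R v) - ?B p\<bar> < e"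
    using near[OF st'(3,4,1,2)] by (intro r(4)) (simp add: r_def)
  ultimately show False using e_def by blast
qed

section \<open>One-forms\<close>

lemma one_form_linear: "one_form_on M \<theta> \<Longrightarrow> p \<in> M \<Longrightarrow> linear (\<theta> p)"
  by (simp add: one_form_on_def)

lemma one_form_smooth: "one_form_on M \<theta> \<Longrightarrow> smooth_on M (\<lambda>p. \<theta> p v)"
  by (simp add: one_form_on_def)

lemma linear_expand_Basis:
  fixes \<phi> :: "'a::euclidean_space \<Rightarrow> real"
  assumes "linear \<phi>"
  shows "\<phi> v = (\<Sum>b\<in>Basis. (v \<bullet> b) * \<phi> b)"
proof -
  have "\<phi> v = \<phi> (\<Sum>b\<in>Basis. (v \<bullet> b) *\<^sub>R b)" by (simp add: euclidean_representation)
  then show ?thesis by (simp only: linear_sum[OF assms] linear_scale[OF assms] real_scaleR_def)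
qed

text \<open>The product rule for the pairing of a form with a vector field, obtained by expanding the
  field in the constant basis.\<close>

lemma has_derivative_one_form_field:
  fixes \<theta> :: "'a::euclidean_space form1"
  assumes "open M" "one_form_on M \<theta>" "p \<in> M" "X differentiable (at p)"
  shows "((\<lambda>q. \<theta> q (X q)) has_derivative
      (\<lambda>u. dird (\<lambda>q. \<theta> q (X p)) p u + \<theta> p (dird X p u))) (at p)"
proof -
  note lin = linear_expand_Basis[OF one_form_linear[OF assms(2)]]
  have d: "((\<lambda>q. \<theta> q b) has_derivative dird (\<lambda>q. \<theta> q b) p) (at p)" for b
    by (intro has_derivative_dird smooth_on_differentiable[OF one_form_smooth[OF assms(2)] assms(3)])
  have "((\<lambda>q. \<Sum>b\<in>Basis. (v \<bullet> b) * \<theta> q b) has_derivative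
      (\<lambda>u. \<Sum>b\<in>Basis. (v \<bullet> b) * dird (\<lambda>q. \<theta> q b) p u)) (at p)" for v
    by (intro has_derivative_sum has_derivative_mult_right d)
  note D = dird_eqI[OF this]
  have *: "dird (\<lambda>q. \<theta> q v) p u = (\<Sum>b\<in>Basis. (v \<bullet> b) * dird (\<lambda>q. \<theta> q b) p u)" for u v
    unfolding D[symmetric] by (rule dird_cong_open[OF assms(1,3)]) (rule lin)
  have "((\<lambda>q. \<Sum>b\<in>Basis. (X q \<bullet> b) * \<theta> q b) has_derivative
      (\<lambda>u. \<Sum>b\<in>Basis. (X p \<bullet> b) * dird (\<lambda>q. \<theta> q b) p u + (dird X p u \<bullet> b) * \<theta> p b)) (at p)"
    by (intro has_derivative_sum has_derivative_mult d has_derivative_inner_left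
        has_derivative_dird[OF assms(4)])
  then have "((\<lambda>q. \<Sum>b\<in>Basis. (X q \<bullet> b) * \<theta> q b) has_derivative
      (\<lambda>u. dird (\<lambda>q. \<theta> q (X p)) p u + \<theta> p (dird X p u))) (at p)"
    by (simp add: *[of "X p"] lin[OF assms(3), of "dird X p _"] sum.distrib)
  then show ?thesis
    by (rule has_derivative_transform_within_open[OF _ assms(1,3)]) (simp add: lin[symmetric])
qed

text \<open>\<open>ext_d1\<close> differentiates along constant fields; for arbitrary fields the derivatives of their
  coefficients are compensated by the Lie bracket.\<close>

lemma ext_d1_fields:
  fixes \<theta> :: "'a::euclidean_space form1"
  assumes "open M" "one_form_on M \<theta>" "p \<in> M" "X differentiable (at p)" "Y differentiable (at p)"
  shows "ext_d1 \<theta> p (X p) (Y p) =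
    dird (\<lambda>q. \<theta> q (Y q)) p (X p) - dird (\<lambda>q. \<theta> q (X q)) p (Y p) - \<theta> p (lie_bracket X Y p)"
proof -
  note D = dird_eqI[OF has_derivative_one_form_field[OF assms(1-3)]]
  show ?thesis
    unfolding D[OF assms(4)] D[OF assms(5)] ext_d1_def lie_bracket_def
    by (simp add: linear_diff[OF one_form_linear[OF assms(2,3)]])
qed

lemma ext_d2_wedge11:
  assumes "open M" "one_form_on M \<alpha>" "one_form_on M \<beta>" "p \<in> M"
  shows "ext_d2 (wedge11 \<alpha> \<beta>) p u v w = wedge12 \<beta> (ext_d1 \<alpha>) p u v w - wedge12 \<alpha> (ext_d1 \<beta>) p u v w"
proof -
  have d: "((\<lambda>q. \<alpha> q a) has_derivative dird (\<lambda>q. \<alpha> q a) p) (at p)"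
    "((\<lambda>q. \<beta> q a) has_derivative dird (\<lambda>q. \<beta> q a) p) (at p)" for a
    by (intro has_derivative_dird smooth_on_differentiable[OF one_form_smooth[OF assms(2)] assms(4)]
        smooth_on_differentiable[OF one_form_smooth[OF assms(3)] assms(4)])+
  have *: "dird (\<lambda>q. wedge11 \<alpha> \<beta> q a b) p c =
      \<alpha> p a * dird (\<lambda>q. \<beta> q b) p c + dird (\<lambda>q. \<alpha> q a) p c * \<beta> p b
      - (\<alpha> p b * dird (\<lambda>q. \<beta> q a) p c + dird (\<lambda>q. \<alpha> q b) p c * \<beta> p a)" for a b c
    unfolding wedge11_def by (intro dird_eqI has_derivative_diff has_derivative_mult d)
  show ?thesis
    unfolding ext_d2_def * wedge12_def ext_d1_def by (simp add: algebra_simps)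
qed

lemma lie_bracket_const: "lie_bracket (\<lambda>_. u) (\<lambda>_. v) = (\<lambda>_. 0)"
proof -
  have "dird (\<lambda>_. c) p w = 0" for c p w :: 'a by (rule dird_eqI) simp
  then show ?thesis by (simp add: lie_bracket_def fun_eq_iff)
qed

lemma one_form_add:
  "open M \<Longrightarrow> one_form_on M \<alpha> \<Longrightarrow> one_form_on M \<beta> \<Longrightarrow> one_form_on M (\<lambda>p v. \<alpha> p v + \<beta> p v)"
  unfolding one_form_on_def by (auto intro!: linear_compose_add smooth_on_add)

lemma one_form_mult:
  "open M \<Longrightarrow> smooth_on M f \<Longrightarrow> one_form_on M \<alpha> \<Longrightarrow> one_form_on M (\<lambda>p v. f p * \<alpha> p v)"
  unfolding one_form_on_def
  by (intro conjI ballI allI linearI)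
    (simp_all add: linear_add linear_scale smooth_on_mult ring_distribs)

lemma one_form_minus: "open M \<Longrightarrow> one_form_on M \<alpha> \<Longrightarrow> one_form_on M (\<lambda>p v. - \<alpha> p v)"
  using one_form_mult[OF _ smooth_on_const[of M "- 1"]] by simp

lemma one_form_diff:
  "open M \<Longrightarrow> one_form_on M \<alpha> \<Longrightarrow> one_form_on M \<beta> \<Longrightarrow> one_form_on M (\<lambda>p v. \<alpha> p v - \<beta> p v)"
  using one_form_add[of M \<alpha> "\<lambda>p v. - \<beta> p v"] one_form_minus[of M \<beta>] by simp

lemma one_form_zero: "one_form_on M (\<lambda>p v. 0)"
  unfolding one_form_on_def by (simp add: linear_zero smooth_on_const)

section \<open>Orthonormal coframes and Cartan's structure equations\<close>

text \<open>Carrying the dual frame along with the coframe avoids inverting Gram matrices: musical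
  isomorphisms and traces become sums over the frame.\<close>

locale orthonormal_coframe =
  fixes M :: "'a::euclidean_space set" and g :: "'a metric_tensor"
    and \<theta> :: "'i::finite \<Rightarrow> 'a form1" and E :: "'i \<Rightarrow> 'a vfield"
  assumes open_M: "open M"
    and form: "one_form_on M (\<theta> i)"
    and frame_smooth: "smooth_on M (E i)"
    and dual: "p \<in> M \<Longrightarrow> \<theta> i p (E j p) = (if i = j then 1 else 0)"
    and expand: "p \<in> M \<Longrightarrow> (\<Sum>i\<in>UNIV. \<theta> i p v *\<^sub>R E i p) = v"
    and metric: "p \<in> M \<Longrightarrow> g p u v = (\<Sum>i\<in>UNIV. \<theta> i p u * \<theta> i p v)"
begin

lemma form_linear: "p \<in> M \<Longrightarrow> linear (\<theta> i p)"
  using form by (rule one_form_linear)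

lemma form_smooth: "smooth_on M (\<lambda>p. \<theta> i p v)"
  using form by (rule one_form_smooth)

lemma coframe_eqI: "p \<in> M \<Longrightarrow> (\<And>i. \<theta> i p u = \<theta> i p v) \<Longrightarrow> u = v"
  by (metis (no_types, lifting) expand sum.cong)

lemma form_frame_sum:
  assumes "p \<in> M"
  shows "\<theta> i p (\<Sum>j\<in>UNIV. c j *\<^sub>R E j p) = c i"
proof -
  have "\<theta> i p (\<Sum>j\<in>UNIV. c j *\<^sub>R E j p) = (\<Sum>j\<in>UNIV. c j * \<theta> i p (E j p))"
    by (simp add: linear_sum[OF form_linear[OF assms]] linear_scale[OF form_linear[OF assms]])
  also have "\<dots> = c i" by (simp add: dual[OF assms] if_distrib cong: if_cong)
  finally show ?thesis .
qed

lemma linear_expand_frame: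
  fixes \<phi> :: "'a \<Rightarrow> 'b::real_vector"
  assumes "p \<in> M" "linear \<phi>"
  shows "\<phi> v = (\<Sum>i\<in>UNIV. \<theta> i p v *\<^sub>R \<phi> (E i p))"
proof -
  have "\<phi> v = \<phi> (\<Sum>i\<in>UNIV. \<theta> i p v *\<^sub>R E i p)" by (simp add: expand[OF assms(1)])
  also have "\<dots> = (\<Sum>i\<in>UNIV. \<theta> i p v *\<^sub>R \<phi> (E i p))"
    by (simp add: linear_sum[OF assms(2)] linear_scale[OF assms(2)])
  finally show ?thesis .
qed

lemma metric_frame: "p \<in> M \<Longrightarrow> g p v (E i p) = \<theta> i p v"
  by (simp add: metric dual if_distrib cong: if_cong)

lemma sharp_coframe:
  assumes "p \<in> M" "\<And>v. \<phi> v = (\<Sum>i\<in>UNIV. c i * \<theta> i p v)"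
  shows "sharp g p \<phi> = (\<Sum>i\<in>UNIV. c i *\<^sub>R E i p)"
  unfolding sharp_def
proof (rule the_equality)
  show "\<forall>v. g p (\<Sum>i\<in>UNIV. c i *\<^sub>R E i p) v = \<phi> v"
    by (simp add: metric[OF assms(1)] form_frame_sum[OF assms(1)] assms(2))
next
  fix w assume w: "\<forall>v. g p w v = \<phi> v"
  have "\<theta> i p w = c i" for i
    using metric_frame[OF assms(1), of w i] w
    by (simp add: assms(2) dual[OF assms(1)] if_distrib cong: if_cong)
  then show "w = (\<Sum>i\<in>UNIV. c i *\<^sub>R E i p)" using expand[OF assms(1), of w] by simp
qed

lemma riemannian_metric: "riemannian_metric_on M g"
  unfolding riemannian_metric_on_def
proof (intro conjI ballI allI impI)
  fix p assume p: "p \<in> M"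
  note lin = form_linear[OF p]
  have "linear (\<lambda>u. c * \<theta> i p u)" for c i
    by (intro linearI) (simp_all add: linear_add[OF lin] linear_scale[OF lin] algebra_simps)
  then have "linear (\<lambda>u. \<Sum>i\<in>UNIV. c i * \<theta> i p u)" for c by (intro linear_compose_sum) simp
  from this[of "\<lambda>i. \<theta> i p _"] show "bilinear (g p)"
    by (simp add: bilinear_def metric[OF p] mult.commute)
  show "g p u v = g p v u" for u v by (simp add: metric[OF p] mult.commute)
  fix v :: 'a assume "v \<noteq> 0"
  then obtain i where "\<theta> i p v \<noteq> 0"
    using coframe_eqI[OF p, of v 0] by (auto simp: linear_0[OF lin])
  then show "g p v v > 0" unfolding metric[OF p]
    by (intro sum_pos2[of UNIV i]) (auto simp: zero_less_mult_iff)
next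
  fix u v
  show "smooth_on M (\<lambda>p. g p u v)"
    by (rule smooth_on_cong[OF open_M metric[symmetric]], assumption)
      (intro smooth_on_sum smooth_on_mult open_M form_smooth)
qed

lemma metric_bilinear: "p \<in> M \<Longrightarrow> bilinear (g p)"
  using riemannian_metric by (simp add: riemannian_metric_on_def)

lemma metric_trace_frame:
  assumes "p \<in> M" "bilinear B"
  shows "metric_trace g p B = (\<Sum>i\<in>UNIV. B (E i p) (E i p))"
proof -
  have lin1: "linear (\<lambda>u. B u v)" and lin2: "linear (B u)" for u v
    using assms(2) by (simp_all add: bilinear_def)
  have "sharp g p (\<lambda>v. b \<bullet> v) = (\<Sum>i\<in>UNIV. (b \<bullet> E i p) *\<^sub>R E i p)" for b
  proof (rule sharp_coframe[OF assms(1)])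
    show "b \<bullet> v = (\<Sum>i\<in>UNIV. b \<bullet> E i p * \<theta> i p v)" for v
      using linear_expand_frame[OF assms(1) bounded_linear.linear[OF bounded_linear_inner_right], of b v]
      by (simp add: mult.commute)
  qed
  then have "metric_trace g p B = (\<Sum>b\<in>Basis. \<Sum>i\<in>UNIV. (E i p \<bullet> b) * B b (E i p))"
    unfolding metric_trace_def by (simp add: linear_sum[OF lin2] linear_scale[OF lin2] inner_commute)
  also have "\<dots> = (\<Sum>i\<in>UNIV. \<Sum>b\<in>Basis. (E i p \<bullet> b) * B b (E i p))" by (rule sum.swap)
  also have "\<dots> = (\<Sum>i\<in>UNIV. B (E i p) (E i p))"
    by (intro sum.cong refl linear_expand_Basis[symmetric] lin1)
  finally show ?thesis .
qed

lemma trace_frame: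
  assumes "p \<in> M" "linear f"
  shows "(\<Sum>b\<in>Basis. f b \<bullet> b) = (\<Sum>i\<in>UNIV. \<theta> i p (f (E i p)))"
proof -
  have "f b \<bullet> b = (\<Sum>i\<in>UNIV. (E i p \<bullet> b) * \<theta> i p (f b))" for b
    using arg_cong[OF expand[OF assms(1), of "f b"], of "\<lambda>v. v \<bullet> b"]
    by (simp add: inner_sum_left mult.commute)
  then have "(\<Sum>b\<in>Basis. f b \<bullet> b) = (\<Sum>b\<in>Basis. \<Sum>i\<in>UNIV. (E i p \<bullet> b) * \<theta> i p (f b))"
    by simp
  also have "\<dots> = (\<Sum>i\<in>UNIV. \<Sum>b\<in>Basis. (E i p \<bullet> b) * \<theta> i p (f b))" by (rule sum.swap)
  also have "\<dots> = (\<Sum>i\<in>UNIV. \<theta> i p (f (E i p)))"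
    using linear_compose[OF assms(2) form_linear[OF assms(1)]]
    by (intro sum.cong refl linear_expand_Basis[symmetric]) (simp add: o_def)
  finally show ?thesis .
qed

end

text \<open>Skew-symmetry of the forms \<open>\<omega>\<close> expresses compatibility of the connection with the metric, and
  the first structure equation the vanishing of its torsion; together they single out the
  Levi-Civita connection.\<close>

locale cartan_structure = orthonormal_coframe M g \<theta> E
  for M :: "'a::euclidean_space set" and g :: "'a metric_tensor"
    and \<theta> :: "'i::finite \<Rightarrow> 'a form1" and E :: "'i \<Rightarrow> 'a vfield" +
  fixes \<omega> :: "'i \<Rightarrow> 'i \<Rightarrow> 'a form1"
  assumes conn_form: "one_form_on M (\<omega> i j)"
    and conn_skew: "p \<in> M \<Longrightarrow> \<omega> i j p u = - \<omega> j i p u"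
    and first_structure: "p \<in> M \<Longrightarrow> ext_d1 (\<theta> i) p u v = - (\<Sum>j\<in>UNIV. wedge11 (\<omega> i j) (\<theta> j) p u v)"
begin

text \<open>The \<open>i\<close>-th frame component of \<open>\<nabla>\<^sub>X Y\<close> for the connection with connection forms \<open>\<omega>\<close>.\<close>

definition nabla :: "'a vfield \<Rightarrow> 'a vfield \<Rightarrow> 'a \<Rightarrow> 'i \<Rightarrow> real" where
  "nabla X Y p i =
     dird (\<lambda>q. \<theta> i q (Y q)) p (X p) + (\<Sum>j\<in>UNIV. \<omega> i j p (X p) * \<theta> j p (Y p))"

definition curv_form :: "'i \<Rightarrow> 'i \<Rightarrow> 'a form2" where
  "curv_form i j p u v = ext_d1 (\<omega> i j) p u v + (\<Sum>k\<in>UNIV. wedge11 (\<omega> i k) (\<omega> k j) p u v)"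

lemma skew_sum_eq_0:
  fixes A :: "'i \<Rightarrow> 'i \<Rightarrow> real"
  assumes "\<And>i j. A i j = - A j i"
  shows "(\<Sum>i\<in>UNIV. \<Sum>j\<in>UNIV. A i j) = 0"
proof -
  have "(\<Sum>i\<in>UNIV. \<Sum>j\<in>UNIV. A i j) = (\<Sum>i\<in>UNIV. \<Sum>j\<in>UNIV. A j i)" by (rule sum.swap)
  also have "\<dots> = - (\<Sum>i\<in>UNIV. \<Sum>j\<in>UNIV. A i j)"
    unfolding sum_negf[symmetric] by (intro sum.cong refl assms)
  finally show ?thesis by simp
qed

text \<open>After the product rule and \<open>ext_d1_fields\<close> the derivatives of the components of \<open>X\<close> and of the
  constant field cancel in the Koszul formula, and those of \<open>Y\<close> appear twice. The remaining terms
  contract the skew forms \<open>\<omega>\<close>, up to the expected part of \<open>\<nabla>\<close>, with symmetric expressions.\<close>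

lemma koszul_coframe:
  assumes p: "p \<in> M" and X: "X differentiable (at p)" and Y: "Y differentiable (at p)"
  shows "koszul g X Y (\<lambda>_. v) p = 2 * (\<Sum>i\<in>UNIV. nabla X Y p i * \<theta> i p v)"
proof -
  have Z: "(\<lambda>_. v) differentiable (at p)" by simp
  have d: "((\<lambda>q. \<theta> i q (W q)) has_derivative dird (\<lambda>q. \<theta> i q (W q)) p) (at p)"
    if "W differentiable (at p)" for i W
    using has_derivative_one_form_field[OF open_M form p that]
    by (intro has_derivative_dird) (auto simp: differentiable_def)
  have prod: "dird (\<lambda>q. g q (V q) (W q)) p u =
      (\<Sum>i\<in>UNIV. \<theta> i p (V p) * dird (\<lambda>q. \<theta> i q (W q)) p u
        + dird (\<lambda>q. \<theta> i q (V q)) p u * \<theta> i p (W p))"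
    if "V differentiable (at p)" "W differentiable (at p)" for V W u
  proof -
    have "dird (\<lambda>q. g q (V q) (W q)) p u
        = dird (\<lambda>q. \<Sum>i\<in>UNIV. \<theta> i q (V q) * \<theta> i q (W q)) p u"
      by (rule dird_cong_open[OF open_M p]) (rule metric)
    also have "\<dots> = (\<Sum>i\<in>UNIV. \<theta> i p (V p) * dird (\<lambda>q. \<theta> i q (W q)) p u
        + dird (\<lambda>q. \<theta> i q (V q)) p u * \<theta> i p (W p))"
      by (intro dird_eqI has_derivative_sum has_derivative_mult d that)
    finally show ?thesis .
  qed
  have br: "g p (lie_bracket V W p) u = (\<Sum>i\<in>UNIV. (dird (\<lambda>q. \<theta> i q (W q)) p (V p)
      - dird (\<lambda>q. \<theta> i q (V q)) p (W p)
      + (\<Sum>j\<in>UNIV. wedge11 (\<omega> i j) (\<theta> j) p (V p) (W p))) * \<theta> i p u)"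
    if "V differentiable (at p)" "W differentiable (at p)" for V W u
    unfolding metric[OF p]
  proof (intro sum.cong refl arg_cong2[of _ _ _ _ "(*)"])
    fix i
    show "\<theta> i p (lie_bracket V W p) = dird (\<lambda>q. \<theta> i q (W q)) p (V p)
      - dird (\<lambda>q. \<theta> i q (V q)) p (W p)
      + (\<Sum>j\<in>UNIV. wedge11 (\<omega> i j) (\<theta> j) p (V p) (W p))"
      using ext_d1_fields[OF open_M form[of i] p that] first_structure[OF p, of i "V p" "W p"]
      by linarith
  qed
  let ?a = "\<lambda>i. \<theta> i p (X p)" and ?b = "\<lambda>i. \<theta> i p (Y p)" and ?z = "\<lambda>i. \<theta> i p v"
  let ?\<omega> = "\<lambda>i j u. \<omega> i j p u"
  let ?T = "\<lambda>i u w. \<Sum>j\<in>UNIV. wedge11 (\<omega> i j) (\<theta> j) p u w"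
  have "koszul g X Y (\<lambda>_. v) p =
      (\<Sum>i\<in>UNIV. 2 * dird (\<lambda>q. \<theta> i q (Y q)) p (X p) * ?z i
        + ?T i (X p) (Y p) * ?z i - ?T i (X p) v * ?b i - ?T i (Y p) v * ?a i)"
    unfolding koszul_def prod[OF Y Z] prod[OF X Z] prod[OF X Y] br[OF X Y] br[OF X Z] br[OF Y Z]
      sum.distrib[symmetric] sum_subtractf[symmetric]
    by (intro sum.cong refl) (simp add: ring_distribs)
  also have "\<dots> = 2 * (\<Sum>i\<in>UNIV. nabla X Y p i * ?z i) +
      (\<Sum>i\<in>UNIV. \<Sum>j\<in>UNIV. - ?\<omega> i j (X p) * (?b j * ?z i + ?b i * ?z j)
          - ?\<omega> i j (Y p) * (?a j * ?z i + ?a i * ?z j) + ?\<omega> i j v * (?a j * ?b i + ?a i * ?b j))"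
    unfolding sum_distrib_left sum.distrib[symmetric]
  proof (intro sum.cong refl)
    fix i
    have "?T i (X p) (Y p) * ?z i - ?T i (X p) v * ?b i - ?T i (Y p) v * ?a i =
        (\<Sum>j\<in>UNIV. 2 * ?\<omega> i j (X p) * ?b j * ?z i) +
        (\<Sum>j\<in>UNIV. - ?\<omega> i j (X p) * (?b j * ?z i + ?b i * ?z j)
          - ?\<omega> i j (Y p) * (?a j * ?z i + ?a i * ?z j) + ?\<omega> i j v * (?a j * ?b i + ?a i * ?b j))"
      unfolding sum_distrib_right sum.distrib[symmetric] sum_subtractf[symmetric]
      by (intro sum.cong refl) (simp add: wedge11_def algebra_simps)
    then show "2 * dird (\<lambda>q. \<theta> i q (Y q)) p (X p) * ?z i
        + ?T i (X p) (Y p) * ?z i - ?T i (X p) v * ?b i - ?T i (Y p) v * ?a i =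
        2 * (nabla X Y p i * ?z i) +
        (\<Sum>j\<in>UNIV. - ?\<omega> i j (X p) * (?b j * ?z i + ?b i * ?z j)
          - ?\<omega> i j (Y p) * (?a j * ?z i + ?a i * ?z j) + ?\<omega> i j v * (?a j * ?b i + ?a i * ?b j))"
      by (simp add: nabla_def ring_distribs sum_distrib_left sum_distrib_right mult.assoc)
  qed
  also have "(\<Sum>i\<in>UNIV. \<Sum>j\<in>UNIV. - ?\<omega> i j (X p) * (?b j * ?z i + ?b i * ?z j)
          - ?\<omega> i j (Y p) * (?a j * ?z i + ?a i * ?z j) + ?\<omega> i j v * (?a j * ?b i + ?a i * ?b j)) = 0"
  \<comment> \<open>every bracket is symmetric in \<open>i\<close> and \<open>j\<close>, every factor \<open>\<omega>\<^sub>i\<^sub>j\<close> is skew\<close>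
  proof (rule skew_sum_eq_0)
    fix i j
    show "- ?\<omega> i j (X p) * (?b j * ?z i + ?b i * ?z j)
          - ?\<omega> i j (Y p) * (?a j * ?z i + ?a i * ?z j) + ?\<omega> i j v * (?a j * ?b i + ?a i * ?b j) =
        - (- ?\<omega> j i (X p) * (?b i * ?z j + ?b j * ?z i)
          - ?\<omega> j i (Y p) * (?a i * ?z j + ?a j * ?z i) + ?\<omega> j i v * (?a i * ?b j + ?a j * ?b i))"
      unfolding conn_skew[OF p, of i j] by (simp add: algebra_simps)
  qed
  finally show ?thesis by simp
qed

lemma levi_civita_coframe:
  assumes "p \<in> M" "X differentiable (at p)" "Y differentiable (at p)"
  shows "levi_civita g X Y p = (\<Sum>i\<in>UNIV. nabla X Y p i *\<^sub>R E i p)"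
  unfolding levi_civita_def
  by (rule sharp_coframe[OF assms(1)]) (simp add: koszul_coframe[OF assms])

lemma form_levi_civita:
  assumes "p \<in> M" "X differentiable (at p)" "Y differentiable (at p)"
  shows "\<theta> i p (levi_civita g X Y p) = nabla X Y p i"
  by (simp add: levi_civita_coframe[OF assms] form_frame_sum[OF assms(1)])

text \<open>Cartan's second structure equation. When \<open>\<nabla>\<^sub>u \<nabla>\<^sub>v w - \<nabla>\<^sub>v \<nabla>\<^sub>u w\<close> is expanded for constant \<open>u\<close>, \<open>v\<close>
  and \<open>w\<close>, the second derivatives of \<open>\<theta>\<^sub>i(w)\<close> cancel by symmetry and the products of \<open>\<omega>\<close> with first
  derivatives of \<open>\<theta>\<^sub>j(w)\<close> cancel in pairs.\<close>

lemma form_curv: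
  assumes p: "p \<in> M"
  shows "\<theta> i p (curv g p u v w) = (\<Sum>j\<in>UNIV. curv_form i j p u v * \<theta> j p w)"
proof -
  have const: "(\<lambda>_. c) differentiable (at q)" for c :: 'a and q :: 'a by simp
  let ?N = "\<lambda>v w q i. dird (\<lambda>r. \<theta> i r w) q v + (\<Sum>j\<in>UNIV. \<omega> i j q v * \<theta> j q w)"
  have N: "nabla (\<lambda>_. v) (\<lambda>_. w) q i = ?N v w q i" for v w q i by (simp add: nabla_def)
  have smooth_N: "smooth_on M (\<lambda>q. ?N v w q i)" for v w i
    by (intro smooth_on_add smooth_on_sum smooth_on_mult smooth_on_dird open_M form_smooth
        one_form_smooth[OF conn_form])
  have diff: "levi_civita g (\<lambda>_. v) (\<lambda>_. w) differentiable (at p)" for v w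
  proof (rule smooth_on_differentiable[OF _ p])
    show "smooth_on M (levi_civita g (\<lambda>_. v) (\<lambda>_. w))"
      by (rule smooth_on_cong[OF open_M levi_civita_coframe[symmetric]], assumption, rule const, rule const)
        (unfold N, intro smooth_on_sum smooth_on_scaleR smooth_N frame_smooth open_M)
  qed
  have d\<theta>: "((\<lambda>q. \<theta> j q w) has_derivative dird (\<lambda>q. \<theta> j q w) p) (at p)"
    and d\<omega>: "((\<lambda>q. \<omega> i j q v) has_derivative dird (\<lambda>q. \<omega> i j q v) p) (at p)"
    and dd\<theta>: "((\<lambda>q. dird (\<lambda>r. \<theta> i r w) q v) has_derivative dird (\<lambda>q. dird (\<lambda>r. \<theta> i r w) q v) p) (at p)"
    for i j v
    by (intro has_derivative_dird smooth_on_differentiable[OF _ p] smooth_on_dird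
        form_smooth one_form_smooth[OF conn_form])+
  have second: "\<theta> i p (levi_civita g (\<lambda>_. u) (levi_civita g (\<lambda>_. v) (\<lambda>_. w)) p) =
      dird (\<lambda>q. dird (\<lambda>r. \<theta> i r w) q v) p u
      + (\<Sum>j\<in>UNIV. \<omega> i j p v * dird (\<lambda>q. \<theta> j q w) p u + dird (\<lambda>q. \<omega> i j q v) p u * \<theta> j p w)
      + (\<Sum>k\<in>UNIV. \<omega> i k p u * ?N v w p k)" for u v
  proof -
    have "dird (\<lambda>q. \<theta> i q (levi_civita g (\<lambda>_. v) (\<lambda>_. w) q)) p u = dird (\<lambda>q. ?N v w q i) p u"
      by (rule dird_cong_open[OF open_M p]) (simp only: form_levi_civita[OF _ const const] N)
    also have "\<dots> = dird (\<lambda>q. dird (\<lambda>r. \<theta> i r w) q v) p u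
      + (\<Sum>j\<in>UNIV. \<omega> i j p v * dird (\<lambda>q. \<theta> j q w) p u + dird (\<lambda>q. \<omega> i j q v) p u * \<theta> j p w)"
      by (intro dird_eqI has_derivative_add has_derivative_sum has_derivative_mult d\<theta> d\<omega> dd\<theta>)
    finally show ?thesis
      unfolding form_levi_civita[OF p const diff] nabla_def
      by (simp only: form_levi_civita[OF p const const] N)
  qed
  have zero: "\<theta> i p (levi_civita g (\<lambda>_. 0) (\<lambda>_. w) p) = 0"
  proof -
    have "dird (\<lambda>q. \<theta> i q w) p 0 = 0"
      using linear_0[OF has_derivative_linear[OF d\<theta>]] .
    moreover have "\<omega> i j p 0 = 0" for j by (rule linear_0[OF one_form_linear[OF conn_form p]])
    ultimately show ?thesis by (simp add: form_levi_civita[OF p const const] N)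
  qed
  have quad: "(\<Sum>k\<in>UNIV. \<omega> i k p u * (\<Sum>j\<in>UNIV. \<omega> k j p v * \<theta> j p w))
      = (\<Sum>j\<in>UNIV. (\<Sum>k\<in>UNIV. \<omega> i k p u * \<omega> k j p v) * \<theta> j p w)" for u v
    unfolding sum_distrib_left sum_distrib_right by (subst sum.swap) (simp add: mult.assoc)
  have comm: "dird (\<lambda>q. dird (\<lambda>r. \<theta> i r w) q v) p u = dird (\<lambda>q. dird (\<lambda>r. \<theta> i r w) q u) p v"
    by (rule dird_dird_commute[OF open_M form_smooth p])
  have "\<theta> i p (curv g p u v w) =
      \<theta> i p (levi_civita g (\<lambda>_. u) (levi_civita g (\<lambda>_. v) (\<lambda>_. w)) p)
      - \<theta> i p (levi_civita g (\<lambda>_. v) (levi_civita g (\<lambda>_. u) (\<lambda>_. w)) p)"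
    by (simp add: curv_def curv_vf_def lie_bracket_const linear_diff[OF form_linear[OF p]] zero)
  also have "\<dots> = (\<Sum>j\<in>UNIV. (dird (\<lambda>q. \<omega> i j q v) p u - dird (\<lambda>q. \<omega> i j q u) p v) * \<theta> j p w)
      + ((\<Sum>j\<in>UNIV. (\<Sum>k\<in>UNIV. \<omega> i k p u * \<omega> k j p v) * \<theta> j p w)
         - (\<Sum>j\<in>UNIV. (\<Sum>k\<in>UNIV. \<omega> i k p v * \<omega> k j p u) * \<theta> j p w))"
    unfolding second comm distrib_left left_diff_distrib sum.distrib sum_subtractf quad
    by simp
  also have "\<dots> = (\<Sum>j\<in>UNIV. curv_form i j p u v * \<theta> j p w)"
    unfolding curv_form_def ext_d1_def wedge11_def sum_subtractf[symmetric] sum.distrib[symmetric]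
    by (intro sum.cong refl) (simp add: sum_subtractf algebra_simps)
  finally show ?thesis .
qed

end

section \<open>The codifferential of a multiple of a coframe form\<close>

context cartan_structure begin

lemma cov_d1_scaled_form:
  assumes p: "p \<in> M" and f: "f differentiable (at p)"
    and \<eta>: "\<And>q v. q \<in> M \<Longrightarrow> \<eta> q v = f q * \<theta> k q v"
  shows "cov_d1 g \<eta> p u v = dird f p u * \<theta> k p v - f p * (\<Sum>j\<in>UNIV. \<omega> k j p u * \<theta> j p v)"
proof -
  have "dird (\<lambda>q. \<eta> q v) p u = dird (\<lambda>q. f q * \<theta> k q v) p u"
    by (rule dird_cong_open[OF open_M p]) (rule \<eta>)
  also have "\<dots> = f p * dird (\<lambda>q. \<theta> k q v) p u + dird f p u * \<theta> k p v"
    by (intro dird_eqI has_derivative_mult has_derivative_dird f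
        smooth_on_differentiable[OF form_smooth p])
  finally show ?thesis
    by (simp add: cov_d1_def \<eta>[OF p] form_levi_civita[OF p] nabla_def distrib_left)
qed

text \<open>The trace of \<open>\<nabla>(f \<theta>\<^sub>k) = df \<otimes> \<theta>\<^sub>k - f \<Sum>\<^sub>j \<omega>\<^sub>k\<^sub>j \<otimes> \<theta>\<^sub>j\<close>.\<close>

lemma codiff1_scaled_form:
  assumes p: "p \<in> M" and f: "f differentiable (at p)"
    and \<eta>: "\<And>q v. q \<in> M \<Longrightarrow> \<eta> q v = f q * \<theta> k q v"
  shows "codiff1 g \<eta> p = f p * (\<Sum>j\<in>UNIV. \<omega> k j p (E j p)) - dird f p (E k p)"
proof -
  note lin = form_linear[OF p] one_form_linear[OF conn_form p]
    has_derivative_linear[OF has_derivative_dird[OF f]]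
  have "cov_d1 g \<eta> p =
      (\<lambda>u v. dird f p u * \<theta> k p v - f p * (\<Sum>j\<in>UNIV. \<omega> k j p u * \<theta> j p v))"
    by (intro ext cov_d1_scaled_form[OF assms])
  then have "bilinear (cov_d1 g \<eta> p)"
    unfolding bilinear_def
    by (auto intro!: linearI simp: lin[THEN linear_add] lin[THEN linear_scale] algebra_simps
        sum.distrib sum_distrib_left)
  then have "codiff1 g \<eta> p = - (\<Sum>i\<in>UNIV. dird f p (E i p) * \<theta> k p (E i p)
      - f p * (\<Sum>j\<in>UNIV. \<omega> k j p (E i p) * \<theta> j p (E i p)))"
    unfolding codiff1_def by (simp add: metric_trace_frame[OF p] cov_d1_scaled_form[OF assms])
  also have "\<dots> = - (dird f p (E k p) - f p * (\<Sum>i\<in>UNIV. \<omega> k i p (E i p)))"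
    unfolding sum_subtractf dual[OF p]
    by (simp add: sum_distrib_left if_distrib[of "\<lambda>x. _ * x"] cong: if_cong)
  finally show ?thesis by simp
qed

lemma form1_norm_sq_scaled_form:
  assumes p: "p \<in> M" and \<eta>: "\<And>q v. q \<in> M \<Longrightarrow> \<eta> q v = f q * \<theta> k q v"
  shows "form1_norm_sq g \<eta> p = (f p)\<^sup>2"
proof -
  have "bilinear (\<lambda>u v. \<eta> p u * \<eta> p v)"
    unfolding bilinear_def \<eta>[OF p]
    by (auto intro!: linearI simp: form_linear[OF p, THEN linear_add]
        form_linear[OF p, THEN linear_scale] algebra_simps)
  then show ?thesis
    unfolding form1_norm_sq_def
    by (simp add: metric_trace_frame[OF p] \<eta>[OF p] dual[OF p] power2_eq_square
        if_distrib[of "\<lambda>x. _ * x"] cong: if_cong)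
qed

end

section \<open>Almost complex structures with constant coefficients in a frame\<close>

context orthonormal_coframe begin

lemma smooth_on_form_field:
  assumes "smooth_on M X"
  shows "smooth_on M (\<lambda>p. \<theta> i p (X p))"
proof (rule smooth_on_cong[OF open_M])
  show "(\<Sum>b\<in>Basis. (X p \<bullet> b) * \<theta> i p b) = \<theta> i p (X p)" if "p \<in> M" for p
    by (rule linear_expand_Basis[OF form_linear[OF that], symmetric])
  show "smooth_on M (\<lambda>p. \<Sum>b\<in>Basis. (X p \<bullet> b) * \<theta> i p b)"
    by (intro smooth_on_sum smooth_on_mult open_M form_smooth
        smooth_on_linear_image[OF _ bounded_linear_inner_left] assms)
qed

text \<open>The endomorphism field whose matrix in the frame is the constant matrix \<open>c\<close>.\<close>

definition frame_endo :: "('i \<Rightarrow> 'i \<Rightarrow> real) \<Rightarrow> 'a endo" where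
  "frame_endo c p v = (\<Sum>i\<in>UNIV. (\<Sum>j\<in>UNIV. c i j * \<theta> j p v) *\<^sub>R E i p)"

lemma form_frame_endo: "p \<in> M \<Longrightarrow> \<theta> i p (frame_endo c p v) = (\<Sum>j\<in>UNIV. c i j * \<theta> j p v)"
  unfolding frame_endo_def by (rule form_frame_sum)

lemma linear_frame_endo:
  assumes "p \<in> M" shows "linear (frame_endo c p)"
proof -
  note lin = form_linear[OF assms]
  show ?thesis
    by (rule linearI; rule coframe_eqI[OF assms])
      (simp_all add: form_frame_endo[OF assms] linear_add[OF lin] linear_scale[OF lin]
        ring_distribs sum.distrib sum_distrib_left mult.left_commute)
qed

lemma smooth_frame_endo: "smooth_on M X \<Longrightarrow> smooth_on M (\<lambda>p. frame_endo c p (X p))"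
  unfolding frame_endo_def
  by (intro smooth_on_sum smooth_on_scaleR smooth_on_mult smooth_on_const open_M frame_smooth
      smooth_on_form_field)

lemma kahler_form_frame_endo:
  "p \<in> M \<Longrightarrow> kahler_form g (frame_endo c) p u v
    = (\<Sum>i\<in>UNIV. (\<Sum>j\<in>UNIV. c i j * \<theta> j p u) * \<theta> i p v)"
  by (simp add: kahler_form_def metric form_frame_endo)

end

text \<open>\<open>square\<close> states that the square of the matrix \<open>c\<close> is \<open>- 1\<close>, in the form in which it acts on
  component vectors.\<close>

locale frame_complex_structure = orthonormal_coframe M g \<theta> E
  for M :: "'a::euclidean_space set" and g :: "'a metric_tensor"
    and \<theta> :: "'i::finite \<Rightarrow> 'a form1" and E :: "'i \<Rightarrow> 'a vfield" +
  fixes c :: "'i \<Rightarrow> 'i \<Rightarrow> real"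
  assumes skew: "c i j = - c j i"
    and square: "(\<Sum>j\<in>UNIV. c i j * (\<Sum>k\<in>UNIV. c j k * a k)) = - a i"
begin

abbreviation J :: "'a endo" where "J \<equiv> frame_endo c"

lemma J_J:
  assumes "p \<in> M"
  shows "J p (J p v) = - v"
proof (rule coframe_eqI[OF assms])
  show "\<theta> i p (J p (J p v)) = \<theta> i p (- v)" for i
    by (simp add: form_frame_endo[OF assms] square linear_neg[OF form_linear[OF assms]])
qed

lemma almost_hermitian: "almost_hermitian_on M g J"
  unfolding almost_hermitian_on_def
proof (intro conjI allI ballI)
  show "riemannian_metric_on M g" by (rule riemannian_metric)
  show "smooth_on M (\<lambda>p. J p v)" for v by (intro smooth_frame_endo smooth_on_const)
  fix p assume p: "p \<in> M"
  show "linear (J p)" by (rule linear_frame_endo[OF p])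
  show "J p (J p v) = - v" for v by (rule J_J[OF p])
  have skew_J: "g p (J p u) v = - g p u (J p v)" for u v
  proof -
    have "g p (J p u) v = (\<Sum>i\<in>UNIV. \<Sum>j\<in>UNIV. c i j * \<theta> j p u * \<theta> i p v)"
      by (simp add: metric[OF p] form_frame_endo[OF p] sum_distrib_right)
    also have "\<dots> = (\<Sum>j\<in>UNIV. \<Sum>i\<in>UNIV. c i j * \<theta> j p u * \<theta> i p v)" by (rule sum.swap)
    also have "\<dots> = (\<Sum>j\<in>UNIV. \<Sum>i\<in>UNIV. - (\<theta> j p u * (c j i * \<theta> i p v)))"
      by (intro sum.cong refl) (subst skew, simp)
    also have "\<dots> = - g p u (J p v)"
      by (simp add: metric[OF p] form_frame_endo[OF p] sum_distrib_left sum_negf)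
    finally show ?thesis .
  qed
  show "g p (J p u) (J p v) = g p u v" for u v
    unfolding skew_J J_J[OF p] by (simp add: metric[OF p] linear_neg[OF form_linear[OF p]] sum_negf)
qed

text \<open>Expressing each Lie bracket through \<open>ext_d1_fields\<close>, all derivatives of components of \<open>X\<close> and \<open>Y\<close>
  cancel, because the matrix \<open>c\<close> is constant and squares to \<open>- 1\<close>. What remains is tensorial, so
  that integrability can be read off from the structure equations.\<close>

lemma nijenhuis_form:
  assumes p: "p \<in> M" and X: "smooth_on M X" and Y: "smooth_on M Y"
  shows "\<theta> i p (nijenhuis J X Y p) =
    ext_d1 (\<theta> i) p (X p) (Y p) - ext_d1 (\<theta> i) p (J p (X p)) (J p (Y p))
    + (\<Sum>j\<in>UNIV. c i j * (ext_d1 (\<theta> j) p (J p (X p)) (Y p) + ext_d1 (\<theta> j) p (X p) (J p (Y p))))"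
proof -
  let ?JX = "\<lambda>q. J q (X q)" and ?JY = "\<lambda>q. J q (Y q)"
  note diff = smooth_on_differentiable[OF _ p]
  have br: "\<theta> i p (lie_bracket V W p) = dird (\<lambda>q. \<theta> i q (W q)) p (V p)
      - dird (\<lambda>q. \<theta> i q (V q)) p (W p) - ext_d1 (\<theta> i) p (V p) (W p)"
    if "smooth_on M V" "smooth_on M W" for V W i
    using ext_d1_fields[OF open_M form[of i] p diff[OF that(1)] diff[OF that(2)]] by linarith
  have D: "dird (\<lambda>q. \<theta> i q (J q (V q))) p u = (\<Sum>j\<in>UNIV. c i j * dird (\<lambda>q. \<theta> j q (V q)) p u)"
    if "smooth_on M V" for V u i
  proof -
    have "dird (\<lambda>q. \<theta> i q (J q (V q))) p u = dird (\<lambda>q. \<Sum>j\<in>UNIV. c i j * \<theta> j q (V q)) p u"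
      by (rule dird_cong_open[OF open_M p]) (rule form_frame_endo)
    also have "\<dots> = (\<Sum>j\<in>UNIV. c i j * dird (\<lambda>q. \<theta> j q (V q)) p u)"
      by (intro dird_eqI has_derivative_sum has_derivative_mult_right has_derivative_dird
          diff smooth_on_form_field that)
    finally show ?thesis .
  qed
  note JX = smooth_frame_endo[OF X, of c] and JY = smooth_frame_endo[OF Y, of c]
  have "\<theta> i p (nijenhuis J X Y p) =
      \<theta> i p (lie_bracket ?JX ?JY p) - (\<Sum>j\<in>UNIV. c i j * \<theta> j p (lie_bracket ?JX Y p))
      - (\<Sum>j\<in>UNIV. c i j * \<theta> j p (lie_bracket X ?JY p)) - \<theta> i p (lie_bracket X Y p)"
    by (simp add: nijenhuis_def linear_diff[OF form_linear[OF p]] form_frame_endo[OF p])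
  also have "\<dots> = ext_d1 (\<theta> i) p (X p) (Y p) - ext_d1 (\<theta> i) p (J p (X p)) (J p (Y p))
    + (\<Sum>j\<in>UNIV. c i j * (ext_d1 (\<theta> j) p (J p (X p)) (Y p) + ext_d1 (\<theta> j) p (X p) (J p (Y p))))"
    unfolding br[OF JX JY] br[OF JX Y] br[OF X JY] br[OF X Y] D[OF X] D[OF Y]
    by (simp only: right_diff_distrib distrib_left sum.distrib sum_subtractf square)
  finally show ?thesis .
qed

lemma hermitian:
  assumes "\<And>p i u v. p \<in> M \<Longrightarrow> ext_d1 (\<theta> i) p u v - ext_d1 (\<theta> i) p (J p u) (J p v)
    + (\<Sum>j\<in>UNIV. c i j * (ext_d1 (\<theta> j) p (J p u) v + ext_d1 (\<theta> j) p u (J p v))) = 0"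
  shows "hermitian_on M g J"
  unfolding hermitian_on_def
proof (intro conjI almost_hermitian allI impI ballI)
  fix X Y :: "'a vfield" and p assume XY: "smooth_on M X" "smooth_on M Y" and p: "p \<in> M"
  show "nijenhuis J X Y p = 0"
  proof (rule coframe_eqI[OF p])
    show "\<theta> i p (nijenhuis J X Y p) = \<theta> i p 0" for i
      by (simp only: nijenhuis_form[OF p XY] assms[OF p] linear_0[OF form_linear[OF p]])
  qed
qed

end

section \<open>Curvature concentrated in one plane\<close>

lemma span_pair: "x \<in> span {y, z} \<longleftrightarrow> (\<exists>k l. x = k *\<^sub>R y + l *\<^sub>R z)"
proof -
  have "x \<in> span {y, z} \<longleftrightarrow> (\<exists>k l. x - k *\<^sub>R y - l *\<^sub>R z = 0)" by (simp add: span_breakdown_eq)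
  then show ?thesis by (simp add: diff_diff_eq)
qed

text \<open>The curvature operator takes its values in, and only depends on, the plane spanned by \<open>E\<^sub>a\<close>
  and \<open>E\<^sub>b\<close>; there it is multiplication by \<open>K\<close>.\<close>

locale planar_curvature = cartan_structure M g \<theta> E \<omega>
  for M :: "'a::euclidean_space set" and g :: "'a metric_tensor"
    and \<theta> :: "'i::finite \<Rightarrow> 'a form1" and E :: "'i \<Rightarrow> 'a vfield"
    and \<omega> :: "'i \<Rightarrow> 'i \<Rightarrow> 'a form1" +
  fixes a b :: 'i and K :: "'a \<Rightarrow> real"
  assumes distinct: "a \<noteq> b"
    and planar: "p \<in> M \<Longrightarrow> curv_form i j p u v =
      (if i = a \<and> j = b then 1 else if i = b \<and> j = a then - 1 else 0)
        * (K p * wedge11 (\<theta> a) (\<theta> b) p u v)"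
begin

lemma curv_eq:
  assumes p: "p \<in> M"
  shows "curv g p u v w =
    (K p * wedge11 (\<theta> a) (\<theta> b) p u v) *\<^sub>R (\<theta> b p w *\<^sub>R E a p - \<theta> a p w *\<^sub>R E b p)"
proof (rule coframe_eqI[OF p])
  fix i
  let ?k = "K p * wedge11 (\<theta> a) (\<theta> b) p u v"
  note lin = form_linear[OF p]
  have "\<theta> i p (curv g p u v w) = (\<Sum>j\<in>UNIV. (if j = b then if i = a then ?k * \<theta> j p w else 0 else 0)
      + (if j = a then if i = b then - ?k * \<theta> j p w else 0 else 0))"
    unfolding form_curv[OF p] planar[OF p] using distinct by (intro sum.cong refl) auto
  also have "\<dots> = (if i = a then ?k * \<theta> b p w else 0) + (if i = b then - ?k * \<theta> a p w else 0)"
    unfolding sum.distrib by simp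
  also have "\<dots> = \<theta> i p (?k *\<^sub>R (\<theta> b p w *\<^sub>R E a p - \<theta> a p w *\<^sub>R E b p))"
    unfolding linear_scale[OF lin] linear_diff[OF lin] dual[OF p] using distinct by simp
  finally show "\<theta> i p (curv g p u v w) = \<theta> i p (?k *\<^sub>R (\<theta> b p w *\<^sub>R E a p - \<theta> a p w *\<^sub>R E b p))" .
qed

lemma ricci_eq:
  assumes p: "p \<in> M"
  shows "ricci g p v w = K p * (\<theta> a p v * \<theta> a p w + \<theta> b p v * \<theta> b p w)"
proof -
  note lin = form_linear[OF p]
  have "linear (\<lambda>u. curv g p u v w)"
    unfolding curv_eq[OF p] wedge11_def
    by (intro linearI)
      (simp_all add: linear_add[OF lin] linear_scale[OF lin] algebra_simps)
  then have "ricci g p v w = (\<Sum>i\<in>UNIV. \<theta> i p (curv g p (E i p) v w))"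
    unfolding ricci_def by (rule trace_frame[OF p])
  also have "\<dots> = (\<Sum>i\<in>UNIV. (if i = a then K p * \<theta> b p v * \<theta> b p w else 0)
      + (if i = b then K p * \<theta> a p v * \<theta> a p w else 0))"
    unfolding curv_eq[OF p] wedge11_def linear_scale[OF lin] linear_diff[OF lin] dual[OF p]
    using distinct by (intro sum.cong refl) (auto simp: algebra_simps)
  also have "\<dots> = K p * (\<theta> a p v * \<theta> a p w + \<theta> b p v * \<theta> b p w)"
    unfolding sum.distrib by (simp add: algebra_simps)
  finally show ?thesis .
qed

lemma scalar_curvature_eq:
  assumes p: "p \<in> M"
  shows "scalar_curvature g p = 2 * K p"
proof -
  note lin = form_linear[OF p]
  have R: "ricci g p = (\<lambda>v w. K p * (\<theta> a p v * \<theta> a p w + \<theta> b p v * \<theta> b p w))"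
    by (intro ext ricci_eq[OF p])
  then have "bilinear (ricci g p)"
    unfolding bilinear_def
    by (auto intro!: linearI simp: linear_add[OF lin] linear_scale[OF lin] algebra_simps)
  then have "scalar_curvature g p = (\<Sum>i\<in>UNIV. (if i = a then K p else 0) + (if i = b then K p else 0))"
    unfolding scalar_curvature_def metric_trace_frame[OF p \<open>bilinear (ricci g p)\<close>]
    unfolding R dual[OF p] using distinct by (intro sum.cong refl) auto
  then show ?thesis by (simp add: sum.distrib)
qed

text \<open>By \<open>curv_eq\<close>, \<open>R(u, v) = k(u, v) j\<close> for a fixed skew endomorphism \<open>j\<close>. The derivation \<open>j\<close>
  commutes with \<open>j\<close> and annihilates \<open>k\<close>, a multiple of the area form of the plane.\<close>

lemma semi_symmetric: "semi_symmetric_on M g"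
  unfolding semi_symmetric_on_def
proof (intro ballI allI)
  fix p x y u v w assume p: "p \<in> M"
  note lin = form_linear[OF p]
  let ?j = "\<lambda>w. \<theta> b p w *\<^sub>R E a p - \<theta> a p w *\<^sub>R E b p"
  let ?k = "\<lambda>u v. K p * wedge11 (\<theta> a) (\<theta> b) p u v"
  have j: "\<theta> a p (?j w) = \<theta> b p w" "\<theta> b p (?j w) = - \<theta> a p w" for w
    using distinct by (simp_all add: linear_diff[OF lin] linear_scale[OF lin] dual[OF p])
  have R: "curv g p u v w = ?k u v *\<^sub>R ?j w" for u v w by (rule curv_eq[OF p])
  have j_scale: "?j (c *\<^sub>R w) = c *\<^sub>R ?j w" for c w
    by (simp add: linear_scale[OF lin] algebra_simps)
  have "?k (c *\<^sub>R ?j u) v + ?k u (c *\<^sub>R ?j v) = 0" for c u v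
    unfolding wedge11_def linear_scale[OF lin] j by (simp add: algebra_simps)
  then have k: "?k (c *\<^sub>R ?j u) v = - ?k u (c *\<^sub>R ?j v)" for c u v
    by (simp add: eq_neg_iff_add_eq_0)
  show "curv g p x y (curv g p u v w) - curv g p (curv g p x y u) v w
      - curv g p u (curv g p x y v) w - curv g p u v (curv g p x y w) = 0"
    unfolding R j_scale k by (simp add: mult.commute)
qed

lemma orth_proj_plane:
  assumes p: "p \<in> M"
  shows "orth_proj g p (span {E a p, E b p}) v = \<theta> a p v *\<^sub>R E a p + \<theta> b p v *\<^sub>R E b p"
  unfolding orth_proj_def
proof (rule the_equality)
  note lin = form_linear[OF p]
  let ?w = "\<theta> a p v *\<^sub>R E a p + \<theta> b p v *\<^sub>R E b p"
  note span = span_pair[of _ "E a p" "E b p"]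
  have perp: "g p (v - (k *\<^sub>R E a p + l *\<^sub>R E b p)) (m *\<^sub>R E a p + n *\<^sub>R E b p)
      = m * (\<theta> a p v - k) + n * (\<theta> b p v - l)" for k l m n
  proof -
    have "g p x (m *\<^sub>R E a p + n *\<^sub>R E b p) = m * \<theta> a p x + n * \<theta> b p x" for x
      by (simp add: bilinear_radd[OF metric_bilinear[OF p]] bilinear_rmul[OF metric_bilinear[OF p]]
          metric_frame[OF p])
    then show ?thesis
      using distinct
      by (simp add: linear_diff[OF lin] linear_add[OF lin] linear_scale[OF lin] dual[OF p])
  qed
  have "g p (v - ?w) u = 0" if u: "u \<in> span {E a p, E b p}" for u
  proof -
    obtain m n where "u = m *\<^sub>R E a p + n *\<^sub>R E b p" using u unfolding span by blast
    then show ?thesis by (simp only: perp) simp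
  qed
  moreover have "?w \<in> span {E a p, E b p}" unfolding span by blast
  ultimately show "?w \<in> span {E a p, E b p} \<and> (\<forall>u\<in>span {E a p, E b p}. g p (v - ?w) u = 0)"
    by blast
  fix w assume w: "w \<in> span {E a p, E b p} \<and> (\<forall>u\<in>span {E a p, E b p}. g p (v - w) u = 0)"
  then have "w \<in> span {E a p, E b p}" ..
  then obtain k l where kl: "w = k *\<^sub>R E a p + l *\<^sub>R E b p" unfolding span by blast
  have 0: "g p (v - w) (m *\<^sub>R E a p + n *\<^sub>R E b p) = 0" for m n
    using w span[of "m *\<^sub>R E a p + n *\<^sub>R E b p"] by blast
  show "w = ?w"
    using 0[of 1 0] 0[of 0 1] unfolding kl perp by simp
qed

lemma distribution_plane: "distribution2_on M (\<lambda>p. span {E a p, E b p})"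
  unfolding distribution2_on_def
proof (intro conjI ballI)
  fix p assume p: "p \<in> M"
  note lin = form_linear[OF p]
  show "subspace (span {E a p, E b p})" by (rule subspace_span)
  have "E a p \<noteq> E b p" using dual[OF p, of a a] dual[OF p, of a b] distinct by auto
  moreover have "independent {E a p, E b p}"
  proof -
    have "E a p \<notin> span {E b p}"
    proof
      assume "E a p \<in> span {E b p}"
      then obtain k where "E a p = k *\<^sub>R E b p" by (auto simp: span_singleton)
      from arg_cong[OF this, of "\<theta> a p"] show False
        using distinct by (simp add: linear_scale[OF lin] dual[OF p])
    qed
    moreover have "E b p \<noteq> 0" using dual[OF p, of b b] linear_0[OF lin] by force
    ultimately show ?thesis using \<open>E a p \<noteq> E b p\<close> by (simp add: independent_insert)
  qed
  ultimately show "dim (span {E a p, E b p}) = 2"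
    by (simp add: dim_eq_card_independent)
  show "\<exists>V X Y. open V \<and> p \<in> V \<and> V \<subseteq> M \<and> smooth_on V X \<and> smooth_on V Y \<and>
      (\<forall>q\<in>V. span {E a q, E b q} = span {X q, Y q})"
    using open_M p frame_smooth by blast
qed

text \<open>For \<open>J\<close> preserving the plane, \<open>R(v, Jv, Jv, v) = K (\<theta>\<^sub>a \<and> \<theta>\<^sub>b)(v, Jv)\<^sup>2\<close>, and
  \<open>(\<theta>\<^sub>a \<and> \<theta>\<^sub>b)(v, Jv) = \<theta>\<^sub>a(v)\<^sup>2 + \<theta>\<^sub>b(v)\<^sup>2\<close> is the squared length of the projection of \<open>v\<close>. So the
  coefficients of the quartic are \<open>0\<close>, \<open>0\<close> and \<open>K\<close>.\<close>

lemma qch_kahler_surface: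
  assumes dim: "DIM('a) = 4" and kahler: "kahler_on M g J"
    and K: "smooth_on M K"
    and J: "\<And>p. p \<in> M \<Longrightarrow> J p (E a p) = E b p"
  shows "qch_kahler_surface_on M g J"
proof -
  have lin_J: "linear (J p)" and J_J: "J p (J p v) = - v" and iso: "g p (J p u) (J p v) = g p u v"
    if "p \<in> M" for p u v
    using kahler that by (auto simp: kahler_on_def hermitian_on_def almost_hermitian_on_def)
  have Jb: "J p (E b p) = - E a p" if "p \<in> M" for p using J_J[OF that, of "E a p"] J[OF that] by simp
  have form_J: "\<theta> a p (J p v) = - \<theta> b p v" "\<theta> b p (J p v) = \<theta> a p v" if p: "p \<in> M" for p v
  proof -
    have neg: "g p x (- y) = - g p x y" for x y
      by (rule bilinear_rneg[OF metric_bilinear[OF p]])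
    have "- \<theta> a p (J p v) = \<theta> b p v"
      using iso[OF p, of v "E b p"] by (simp add: Jb[OF p] neg metric_frame[OF p])
    then show "\<theta> a p (J p v) = - \<theta> b p v" by simp
    show "\<theta> b p (J p v) = \<theta> a p v"
      using iso[OF p, of v "E a p"] by (simp add: J[OF p] metric_frame[OF p])
  qed
  have inv: "J p ` span {E a p, E b p} \<subseteq> span {E a p, E b p}" if p: "p \<in> M" for p
  proof -
    have "J p ` span {E a p, E b p} = span (J p ` {E a p, E b p})"
      by (rule linear_span_image[OF lin_J[OF p], symmetric])
    also have "\<dots> = span {E b p, - E a p}" by (simp add: J[OF p] Jb[OF p])
    also have "\<dots> \<subseteq> span {E a p, E b p}"
      by (intro span_minimal subspace_span) (auto intro: span_neg span_base)
    finally show ?thesis .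
  qed
  have hol: "curv4 g p v (J p v) (J p v) v = 0 + 0 * s ^ 2 + K p * s ^ 4"
    if p: "p \<in> M" and s: "s = metric_norm g p (orth_proj g p (span {E a p, E b p}) v)" for p v s
  proof -
    note lin = form_linear[OF p]
    have "g p (curv g p v (J p v) (J p v)) v = K p * wedge11 (\<theta> a) (\<theta> b) p v (J p v)
        * (\<theta> b p (J p v) * g p (E a p) v - \<theta> a p (J p v) * g p (E b p) v)"
      unfolding curv_eq[OF p]
      by (simp add: bilinear_lsub[OF metric_bilinear[OF p]] bilinear_lmul[OF metric_bilinear[OF p]])
    moreover have "g p (E i p) v = \<theta> i p v" for i
      using metric_frame[OF p] by (simp add: metric[OF p] mult.commute)
    ultimately have R: "curv4 g p v (J p v) (J p v) v = K p * (\<theta> a p v ^ 2 + \<theta> b p v ^ 2) ^ 2"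
      by (simp add: curv4_def form_J[OF p] wedge11_def power2_eq_square algebra_simps)
    let ?w = "\<theta> a p v *\<^sub>R E a p + \<theta> b p v *\<^sub>R E b p"
    have "\<theta> i p ?w * \<theta> i p ?w =
        (if i = a then \<theta> a p v ^ 2 else 0) + (if i = b then \<theta> b p v ^ 2 else 0)" for i
      using distinct
      by (simp add: linear_add[OF lin] linear_scale[OF lin] dual[OF p] power2_eq_square)
    then have "g p ?w ?w = \<theta> a p v ^ 2 + \<theta> b p v ^ 2"
      by (simp add: metric[OF p] sum.distrib)
    then have "s ^ 2 = \<theta> a p v ^ 2 + \<theta> b p v ^ 2"
      unfolding s orth_proj_plane[OF p] metric_norm_def by simp
    moreover have "s ^ 4 = (s ^ 2) ^ 2" by simp
    ultimately show ?thesis using R by simp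
  qed
  show ?thesis
    unfolding qch_kahler_surface_on_def Let_def
    using dim kahler distribution_plane inv K hol[OF _ refl]
    by (intro conjI exI[of _ "\<lambda>p. span {E a p, E b p}"] exI[of _ K] exI[of _ "\<lambda>_. 0"])
      (simp_all add: smooth_on_const)
qed

end

section \<open>The metric and its coframe\<close>

abbreviation x_comp :: "(real \<times> real) \<times> (real \<times> real) \<Rightarrow> real" where "x_comp v \<equiv> fst (fst v)"
abbreviation y_comp :: "(real \<times> real) \<times> (real \<times> real) \<Rightarrow> real" where "y_comp v \<equiv> snd (fst v)"
abbreviation z_comp :: "(real \<times> real) \<times> (real \<times> real) \<Rightarrow> real" where "z_comp v \<equiv> fst (snd v)"
abbreviation t_comp :: "(real \<times> real) \<times> (real \<times> real) \<Rightarrow> real" where "t_comp v \<equiv> snd (snd v)"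

lemma dird_xy:
  assumes "f differentiable (at q)"
  shows "dird f q w = d_x f q * fst w + d_y f q * snd w"
proof -
  have lin: "linear (dird f q)" using has_derivative_linear[OF has_derivative_dird[OF assms]] .
  have "dird f q w = dird f q (fst w *\<^sub>R (1, 0) + snd w *\<^sub>R (0, 1))" by simp
  also have "\<dots> = d_x f q * fst w + d_y f q * snd w"
    unfolding linear_add[OF lin] linear_scale[OF lin] d_x_def d_y_def by simp
  finally show ?thesis .
qed

text \<open>The projection \<open>M \<rightarrow> U\<close> is the bundle. On its fibres the metric is \<open>dz\<^sup>2 + (z/2)\<^sup>2 dt\<^sup>2\<close>, the
  flat metric in polar coordinates.\<close>

locale bundle_metric =
  fixes U :: "(real \<times> real) set" and h H :: "real \<times> real \<Rightarrow> real"
  assumes open_U: "open U" and U_nonempty: "U \<noteq> {}"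
    and smooth_h: "smooth_on U h" and h_pos: "q \<in> U \<Longrightarrow> h q > 0"
    and smooth_H: "smooth_on U H" and H_pos: "q \<in> U \<Longrightarrow> H q > 0"
    and laplace_ln_H: "q \<in> U \<Longrightarrow> flat_laplacian (\<lambda>r. ln (H r)) q = 2 * (h q)\<^sup>2"
begin

definition M :: "((real \<times> real) \<times> (real \<times> real)) set" where
  "M = U \<times> {(z, t). z < 0}"

definition l :: "real \<times> real \<Rightarrow> real" where "l = (\<lambda>q. - d_y (\<lambda>r. ln (H r)) q)"
definition n :: "real \<times> real \<Rightarrow> real" where "n = (\<lambda>q. d_x (\<lambda>r. ln (H r)) q)"
definition a :: "real \<times> real \<Rightarrow> real" where "a = (\<lambda>q. d_x (\<lambda>r. ln (h r)) q)"
definition b :: "real \<times> real \<Rightarrow> real" where "b = (\<lambda>q. d_y (\<lambda>r. ln (h r)) q)"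

text \<open>The connection form of \<open>h\<^sup>2 (dx\<^sup>2 + dy\<^sup>2)\<close>: \<open>d(h dx) = - \<sigma> \<and> h dy\<close> and \<open>d(h dy) = \<sigma> \<and> h dx\<close>.\<close>

definition \<sigma> :: "((real \<times> real) \<times> (real \<times> real)) form1" where
  "\<sigma> p v = b (fst p) * x_comp v - a (fst p) * y_comp v"

text \<open>For \<open>A + iB = H e^{it/2} (dx + i dy)\<close> this form satisfies \<open>dA = \<psi> \<and> B\<close> and \<open>dB = - \<psi> \<and> A\<close>.\<close>

definition \<psi> :: "((real \<times> real) \<times> (real \<times> real)) form1" where
  "\<psi> p v = l (fst p) * x_comp v + n (fst p) * y_comp v - t_comp v / 2"

definition \<theta> :: "4 \<Rightarrow> ((real \<times> real) \<times> (real \<times> real)) form1" where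
  "\<theta> i p v =
     (if i = 1 then z_comp p * h (fst p) * x_comp v
      else if i = 2 then z_comp p * h (fst p) * y_comp v
      else if i = 3 then
        H (fst p) * (cos (t_comp p / 2) * x_comp v - sin (t_comp p / 2) * y_comp v) + z_comp p * \<psi> p v
      else z_comp v - H (fst p) * (sin (t_comp p / 2) * x_comp v + cos (t_comp p / 2) * y_comp v))"

text \<open>Dual to the coframe \<open>\<theta>\<close>.\<close>

definition E :: "4 \<Rightarrow> ((real \<times> real) \<times> (real \<times> real)) vfield" where
  "E i p =
     (let z = z_comp p; s = sin (t_comp p / 2); c = cos (t_comp p / 2); q = fst p
      in if i = 1 then
        ((1 / (z * h q), 0), (s * H q / (z * h q), 2 * (c * H q + z * l q) / (z * z * h q)))
      else if i = 2 then
        ((0, 1 / (z * h q)), (c * H q / (z * h q), 2 * (- s * H q + z * n q) / (z * z * h q)))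
      else if i = 3 then ((0, 0), (0, - 2 / z))
      else ((0, 0), (1, 0)))"

text \<open>The solution of the first structure equations. Its entries that link the directions \<open>1, 2\<close> with
  the fibre directions \<open>3, 4\<close> are pulled back from \<open>U\<close>.\<close>

definition \<omega> :: "4 \<Rightarrow> 4 \<Rightarrow> ((real \<times> real) \<times> (real \<times> real)) form1" where
  "\<omega> i j p v =
     (if i = 1 \<and> j = 2 then \<sigma> p v - \<psi> p v
      else if i = 2 \<and> j = 1 then \<psi> p v - \<sigma> p v
      else if i = 3 \<and> j = 4 then \<psi> p v
      else if i = 4 \<and> j = 3 then - \<psi> p v
      else if i = 1 \<and> j = 4 \<or> i = 2 \<and> j = 3 then h (fst p) * x_comp v
      else if i = 4 \<and> j = 1 \<or> i = 3 \<and> j = 2 then - (h (fst p) * x_comp v)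
      else if i = 2 \<and> j = 4 \<or> i = 3 \<and> j = 1 then h (fst p) * y_comp v
      else if i = 4 \<and> j = 2 \<or> i = 1 \<and> j = 3 then - (h (fst p) * y_comp v)
      else 0)"

definition g :: "((real \<times> real) \<times> (real \<times> real)) metric_tensor" where
  "g p u v = (\<Sum>i\<in>UNIV. \<theta> i p u * \<theta> i p v)"

definition K :: "(real \<times> real) \<times> (real \<times> real) \<Rightarrow> real" where
  "K p = - flat_laplacian (\<lambda>r. ln (h r)) (fst p) / ((z_comp p)\<^sup>2 * (h (fst p))\<^sup>2) - 4 / (z_comp p)\<^sup>2"

lemma M_D: "p \<in> M \<Longrightarrow> fst p \<in> U" "p \<in> M \<Longrightarrow> z_comp p < 0"
  by (auto simp: M_def)

lemma open_M: "open M"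
proof -
  have "{(z, t). z < (0::real)} = {..<0} \<times> (UNIV :: real set)" by auto
  then show ?thesis unfolding M_def by (simp add: open_U open_Times)
qed

lemma smooth_base: "smooth_on U f \<Longrightarrow> smooth_on M (\<lambda>p. f (fst p))"
  by (rule smooth_on_linear_preimage[OF open_M bounded_linear_fst]) (auto simp: M_def)

lemma smooth_z: "smooth_on M (\<lambda>p. z_comp p)" and smooth_t: "smooth_on M (\<lambda>p. t_comp p)"
  by (intro smooth_on_linear open_M bounded_linear_compose[OF bounded_linear_fst bounded_linear_snd]
      bounded_linear_compose[OF bounded_linear_snd bounded_linear_snd])+

lemma smooth_coefs: "smooth_on U l" "smooth_on U n" "smooth_on U a" "smooth_on U b"
  unfolding l_def n_def a_def b_def d_x_def d_y_def
  by (intro smooth_intros open_U smooth_h smooth_H h_pos H_pos; assumption)+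

lemmas smooth_M_intros = smooth_intros open_M smooth_base smooth_z smooth_t smooth_coefs smooth_h smooth_H

lemma has_derivative_base:
  assumes "smooth_on U f" "p \<in> M"
  shows "((\<lambda>p. f (fst p)) has_derivative
    (\<lambda>u. d_x f (fst p) * x_comp u + d_y f (fst p) * y_comp u)) (at p)"
proof -
  have "f differentiable (at (fst p))"
    using smooth_on_differentiable[OF assms(1) M_D(1)[OF assms(2)]] .
  from has_derivative_compose[OF has_derivative_fst[OF has_derivative_ident] has_derivative_dird[OF this]]
    dird_xy[OF this]
  show ?thesis by simp
qed

lemma d_x_of_ln_derivs:
  assumes "smooth_on U f" "\<And>q. q \<in> U \<Longrightarrow> f q > 0" "q \<in> U"
  shows "d_x f q = f q * d_x (\<lambda>r. ln (f r)) q" "d_y f q = f q * d_y (\<lambda>r. ln (f r)) q"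
  using dird_eqI[OF has_derivative_ln_dird[OF smooth_on_differentiable[OF assms(1,3)] assms(2)[OF assms(3)]]]
    assms(2)[OF assms(3)]
  by (simp_all add: d_x_def d_y_def)

lemma derivs:
  assumes "p \<in> M"
  shows "((\<lambda>p. H (fst p)) has_derivative
      (\<lambda>u. H (fst p) * (n (fst p) * x_comp u - l (fst p) * y_comp u))) (at p)"
    and "((\<lambda>p. h (fst p)) has_derivative
      (\<lambda>u. h (fst p) * (a (fst p) * x_comp u + b (fst p) * y_comp u))) (at p)"
  using has_derivative_base[OF smooth_H assms] has_derivative_base[OF smooth_h assms]
    d_x_of_ln_derivs[OF smooth_H H_pos M_D(1)[OF assms]]
    d_x_of_ln_derivs[OF smooth_h h_pos M_D(1)[OF assms]]
  by (simp_all add: l_def n_def a_def b_def algebra_simps)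

text \<open>The equation for \<open>H\<close> in the form in which it determines \<open>d\<psi>\<close>.\<close>

lemma laplace_l_n: "q \<in> U \<Longrightarrow> d_x n q - d_y l q = 2 * (h q)\<^sup>2"
proof -
  assume q: "q \<in> U"
  have "d_y l q = - d_y (d_y (\<lambda>r. ln (H r))) q"
  proof -
    have "(d_y (\<lambda>r. ln (H r))) differentiable (at q)"
      using smooth_on_differentiable[OF smooth_on_minus[OF open_U smooth_coefs(1)] q]
      by (simp add: l_def)
    from dird_eqI[OF has_derivative_minus[OF has_derivative_dird[OF this]]]
    show ?thesis by (simp add: l_def d_y_def[of "\<lambda>q. - _ q"] d_y_def[of "d_y _"])
  qed
  with laplace_ln_H[OF q] show ?thesis by (simp add: flat_laplacian_def n_def)
qed

lemma laplace_a_b: "d_x a q + d_y b q = flat_laplacian (\<lambda>r. ln (h r)) q"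
  by (simp add: flat_laplacian_def a_def b_def)

lemma ext_d1_psi:
  assumes "p \<in> M"
  shows "ext_d1 \<psi> p u v = 2 * (h (fst p))\<^sup>2 * (x_comp u * y_comp v - x_comp v * y_comp u)"
proof -
  have D: "dird (\<lambda>q. \<psi> q v) p u = (d_x l (fst p) * x_comp u + d_y l (fst p) * y_comp u) * x_comp v
      + (d_x n (fst p) * x_comp u + d_y n (fst p) * y_comp u) * y_comp v" for u v
    unfolding \<psi>_def
    by (rule dird_eqI) (auto intro!: derivative_eq_intros has_derivative_base[OF smooth_coefs(1) assms]
        has_derivative_base[OF smooth_coefs(2) assms])
  show ?thesis
    unfolding ext_d1_def D laplace_l_n[OF M_D(1)[OF assms], symmetric] by (simp add: algebra_simps)
qed

lemma ext_d1_sigma: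
  assumes "p \<in> M"
  shows "ext_d1 \<sigma> p u v =
    - flat_laplacian (\<lambda>r. ln (h r)) (fst p) * (x_comp u * y_comp v - x_comp v * y_comp u)"
proof -
  have D: "dird (\<lambda>q. \<sigma> q v) p u = (d_x b (fst p) * x_comp u + d_y b (fst p) * y_comp u) * x_comp v
      - (d_x a (fst p) * x_comp u + d_y a (fst p) * y_comp u) * y_comp v" for u v
    unfolding \<sigma>_def
    by (rule dird_eqI) (auto intro!: derivative_eq_intros has_derivative_base[OF smooth_coefs(3) assms]
        has_derivative_base[OF smooth_coefs(4) assms])
  show ?thesis
    unfolding ext_d1_def D laplace_a_b[symmetric] by (simp add: algebra_simps)
qed


lemma one_form_coordinates:
  assumes "\<And>p v. \<eta> p v = A p * x_comp v + B p * y_comp v + C p * z_comp v + D p * t_comp v"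
    and "smooth_on M A" "smooth_on M B" "smooth_on M C" "smooth_on M D"
  shows "one_form_on M \<eta>"
  unfolding one_form_on_def assms(1)
  by (auto intro!: linearI smooth_M_intros assms simp: algebra_simps)

lemma one_form_psi: "one_form_on M \<psi>"
  by (rule one_form_coordinates[where A="\<lambda>p. l (fst p)" and B="\<lambda>p. n (fst p)"
        and C="\<lambda>_. 0" and D="\<lambda>_. - 1/2"])
    (auto simp: \<psi>_def intro!: smooth_M_intros)

lemma one_form_sigma: "one_form_on M \<sigma>"
  by (rule one_form_coordinates[where A="\<lambda>p. b (fst p)" and B="\<lambda>p. - a (fst p)"
        and C="\<lambda>_. 0" and D="\<lambda>_. 0"])
    (auto simp: \<sigma>_def intro!: smooth_M_intros open_U)

lemma one_form_dx: "smooth_on M f \<Longrightarrow> one_form_on M (\<lambda>p v. f p * x_comp v)"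
  and one_form_dy: "smooth_on M f \<Longrightarrow> one_form_on M (\<lambda>p v. f p * y_comp v)"
  unfolding one_form_on_def by (auto intro!: linearI smooth_M_intros simp: algebra_simps)

lemma coframe_eqs:
  "\<theta> 1 = (\<lambda>p v. z_comp p * h (fst p) * x_comp v)"
  "\<theta> 2 = (\<lambda>p v. z_comp p * h (fst p) * y_comp v)"
  "\<theta> 3 = (\<lambda>p v. H (fst p) * (cos (t_comp p / 2) * x_comp v - sin (t_comp p / 2) * y_comp v)
      + z_comp p * \<psi> p v)"
  "\<theta> 4 = (\<lambda>p v. z_comp v - H (fst p) * (sin (t_comp p / 2) * x_comp v + cos (t_comp p / 2) * y_comp v))"
  by (simp_all add: fun_eq_iff \<theta>_def)

lemma one_form_theta: "one_form_on M (\<theta> i)"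
proof -
  have "one_form_on M (\<theta> 1)" "one_form_on M (\<theta> 2)"
    unfolding coframe_eqs by (intro one_form_dx one_form_dy smooth_M_intros)+
  moreover have "one_form_on M (\<theta> 3)"
    by (rule one_form_coordinates[where A="\<lambda>p. H (fst p) * cos (t_comp p / 2) + z_comp p * l (fst p)"
        and B="\<lambda>p. - H (fst p) * sin (t_comp p / 2) + z_comp p * n (fst p)" and C="\<lambda>_. 0"
        and D="\<lambda>p. - z_comp p / 2"])
      (auto simp: coframe_eqs \<psi>_def algebra_simps intro!: smooth_M_intros)
  moreover have "one_form_on M (\<theta> 4)"
    by (rule one_form_coordinates[where A="\<lambda>p. - H (fst p) * sin (t_comp p / 2)"
        and B="\<lambda>p. - H (fst p) * cos (t_comp p / 2)" and C="\<lambda>_. 1" and D="\<lambda>_. 0"])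
      (auto simp: coframe_eqs algebra_simps intro!: smooth_M_intros)
  ultimately show ?thesis using exhaust_4[of i] by auto
qed

lemma one_form_omega: "one_form_on M (\<omega> i j)"
  using exhaust_4[of i] exhaust_4[of j]
  by (auto simp: \<omega>_def[abs_def] intro!: one_form_diff one_form_minus one_form_zero one_form_dx one_form_dy
      one_form_psi one_form_sigma smooth_M_intros open_M)

lemma smooth_E: "smooth_on M (E i)"
proof -
  have z: "z_comp p \<noteq> 0" "h (fst p) \<noteq> 0" if "p \<in> M" for p
    using M_D[OF that] h_pos[of "fst p"] by auto
  have "smooth_on M (\<lambda>p. E i p)"
    using exhaust_4[of i]
    by (elim disjE; simp add: E_def Let_def; intro smooth_M_intros) (simp_all add: z)
  then show ?thesis by simp
qed

lemma ext_d1_theta: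
  assumes "p \<in> M"
  shows "ext_d1 (\<theta> i) p u v = - (\<Sum>j\<in>UNIV. wedge11 (\<omega> i j) (\<theta> j) p u v)"
proof -
  let ?c = "cos (t_comp p / 2)" and ?s = "sin (t_comp p / 2)" and ?q = "fst p" and ?z = "z_comp p"
  note [derivative_intros] = derivs[OF assms] has_derivative_base[OF smooth_coefs(1) assms]
    has_derivative_base[OF smooth_coefs(2) assms]
  have \<psi>: "((\<lambda>q. \<psi> q v) has_derivative dird (\<lambda>q. \<psi> q v) p) (at p)" for v
    by (intro has_derivative_dird smooth_on_differentiable[OF one_form_smooth[OF one_form_psi] assms])
  have D1: "dird (\<lambda>q. \<theta> 1 q v) p u = (z_comp u + ?z * (a ?q * x_comp u + b ?q * y_comp u)) * h ?q * x_comp v"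
    "dird (\<lambda>q. \<theta> 2 q v) p u = (z_comp u + ?z * (a ?q * x_comp u + b ?q * y_comp u)) * h ?q * y_comp v"
    for u v
    unfolding coframe_eqs
    by (rule dird_eqI, auto intro!: derivative_eq_intros simp: algebra_simps)+
  have D3: "dird (\<lambda>q. \<theta> 3 q v) p u =
      H ?q * (n ?q * x_comp u - l ?q * y_comp u) * (?c * x_comp v - ?s * y_comp v)
      - H ?q * (t_comp u / 2) * (?s * x_comp v + ?c * y_comp v)
      + z_comp u * \<psi> p v + ?z * dird (\<lambda>q. \<psi> q v) p u" for u v
    unfolding coframe_eqs
    by (rule dird_eqI) (auto intro!: derivative_eq_intros \<psi> simp: algebra_simps)
  have D4: "dird (\<lambda>q. \<theta> 4 q v) p u =
      - H ?q * (n ?q * x_comp u - l ?q * y_comp u) * (?s * x_comp v + ?c * y_comp v)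
      - H ?q * (t_comp u / 2) * (?c * x_comp v - ?s * y_comp v)" for u v
    unfolding coframe_eqs
    by (rule dird_eqI) (auto intro!: derivative_eq_intros simp: algebra_simps)
  have d\<psi>: "dird (\<lambda>q. \<psi> q v) p u = 2 * (h ?q)\<^sup>2 * (x_comp u * y_comp v - x_comp v * y_comp u)
      + dird (\<lambda>q. \<psi> q u) p v"
    using ext_d1_psi[OF assms, of u v] unfolding ext_d1_def by linarith
  have "ext_d1 (\<theta> 1) p u v = - (\<Sum>j\<in>UNIV. wedge11 (\<omega> 1 j) (\<theta> j) p u v)"
    unfolding ext_d1_def D1 sum_4 wedge11_def
    by (simp add: \<omega>_def coframe_eqs \<sigma>_def \<psi>_def algebra_simps)
  moreover have "ext_d1 (\<theta> 2) p u v = - (\<Sum>j\<in>UNIV. wedge11 (\<omega> 2 j) (\<theta> j) p u v)"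
    unfolding ext_d1_def D1 sum_4 wedge11_def
    by (simp add: \<omega>_def coframe_eqs \<sigma>_def \<psi>_def algebra_simps)
  moreover have "ext_d1 (\<theta> 3) p u v = - (\<Sum>j\<in>UNIV. wedge11 (\<omega> 3 j) (\<theta> j) p u v)"
    unfolding ext_d1_def D3 d\<psi> sum_4 wedge11_def
    by (simp add: \<omega>_def coframe_eqs \<psi>_def algebra_simps power2_eq_square)
  moreover have "ext_d1 (\<theta> 4) p u v = - (\<Sum>j\<in>UNIV. wedge11 (\<omega> 4 j) (\<theta> j) p u v)"
    unfolding ext_d1_def D4 sum_4 wedge11_def
    by (simp add: \<omega>_def coframe_eqs \<psi>_def algebra_simps)
  ultimately show ?thesis using exhaust_4[of i] by auto
qed


lemma dual_frame:
  assumes "p \<in> M"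
  shows "\<theta> i p (E j p) = (if i = j then 1 else 0)"
proof -
  have "z_comp p \<noteq> 0" "h (fst p) \<noteq> 0"
    using M_D[OF assms] h_pos[of "fst p"] by auto
  then show ?thesis
    using exhaust_4[of i] exhaust_4[of j]
    by (elim disjE) (simp_all add: \<theta>_def \<psi>_def E_def Let_def field_simps)
qed

lemma expand_frame:
  assumes "p \<in> M"
  shows "(\<Sum>i\<in>UNIV. \<theta> i p v *\<^sub>R E i p) = v"
proof -
  have "z_comp p \<noteq> 0" "h (fst p) \<noteq> 0"
    using M_D[OF assms] h_pos[of "fst p"] by auto
  then show ?thesis
    by (simp add: sum_4 \<theta>_def \<psi>_def E_def Let_def prod_eq_iff field_simps)
qed

lemma omega_skew: "\<omega> i j p u = - \<omega> j i p u"
  using exhaust_4[of i] exhaust_4[of j] by (elim disjE) (simp_all add: \<omega>_def)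

sublocale cartan_structure M g \<theta> E \<omega>
  by unfold_locales
    (rule open_M one_form_theta smooth_E one_form_omega g_def omega_skew
      | rule dual_frame expand_frame ext_d1_theta, assumption)+

lemma omega_eqs:
  "\<omega> 1 2 = (\<lambda>p v. \<sigma> p v - \<psi> p v)" "\<omega> 3 4 = \<psi>"
  "\<omega> 1 3 = (\<lambda>p v. - (h (fst p) * y_comp v))" "\<omega> 1 4 = (\<lambda>p v. h (fst p) * x_comp v)"
  "\<omega> 2 3 = (\<lambda>p v. h (fst p) * x_comp v)" "\<omega> 2 4 = (\<lambda>p v. h (fst p) * y_comp v)"
  by (simp_all add: \<omega>_def fun_eq_iff)

lemma curv_form_skew:
  assumes "p \<in> M"
  shows "curv_form i j p u v = - curv_form j i p u v"
proof -
  have "ext_d1 (\<omega> i j) p u v = - ext_d1 (\<omega> j i) p u v"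
  proof -
    have "dird (\<lambda>q. \<omega> i j q v) p u = - dird (\<lambda>q. \<omega> j i q v) p u" for u v
      unfolding omega_skew[of i j]
      by (intro dird_eqI has_derivative_minus has_derivative_dird
          smooth_on_differentiable[OF one_form_smooth[OF one_form_omega] assms])
    then show ?thesis by (simp add: ext_d1_def)
  qed
  moreover have "wedge11 (\<omega> i k) (\<omega> k j) p u v = - wedge11 (\<omega> j k) (\<omega> k i) p u v" for k
    unfolding wedge11_def omega_skew[of i k] omega_skew[of k j] by simp
  ultimately show ?thesis by (simp add: curv_form_def sum_negf)
qed

text \<open>In \<open>d\<omega>\<^sub>3\<^sub>4 = d\<psi> = 2 h\<^sup>2 dx \<and> dy\<close> the right-hand side is exactly cancelled by the quadratic terms
  of the curvature, while in \<open>d\<omega>\<^sub>1\<^sub>2 = d\<sigma> - d\<psi>\<close> they double it. The four mixed curvature forms vanish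
  because \<open>\<sigma>\<close> is the connection form of the base.\<close>

lemma planar_curv_form:
  assumes p: "p \<in> M"
  shows "curv_form i j p u v =
      (if i = 1 \<and> j = 2 then 1 else if i = 2 \<and> j = 1 then - 1 else 0)
        * (K p * wedge11 (\<theta> 1) (\<theta> 2) p u v)"
proof -
  let ?q = "fst p"
  have nz: "z_comp p \<noteq> 0" "h (fst p) \<noteq> 0"
    using M_D[OF p] h_pos[of "fst p"] by auto
  have dx: "ext_d1 (\<lambda>p v. h (fst p) * x_comp v) p u v =
      - h ?q * b ?q * (x_comp u * y_comp v - x_comp v * y_comp u)" for u v
  proof -
    have "dird (\<lambda>q. h (fst q) * x_comp v) p u =
        h ?q * (a ?q * x_comp u + b ?q * y_comp u) * x_comp v" for u v
      by (rule dird_eqI) (auto intro!: derivative_eq_intros derivs[OF p])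
    then show ?thesis by (simp add: ext_d1_def algebra_simps)
  qed
  have dy: "ext_d1 (\<lambda>p v. h (fst p) * y_comp v) p u v =
      h ?q * a ?q * (x_comp u * y_comp v - x_comp v * y_comp u)" for u v
  proof -
    have "dird (\<lambda>q. h (fst q) * y_comp v) p u =
        h ?q * (a ?q * x_comp u + b ?q * y_comp u) * y_comp v" for u v
      by (rule dird_eqI) (auto intro!: derivative_eq_intros derivs[OF p])
    then show ?thesis by (simp add: ext_d1_def algebra_simps)
  qed
  have dy': "ext_d1 (\<lambda>p v. - (h (fst p) * y_comp v)) p u v =
      - h ?q * a ?q * (x_comp u * y_comp v - x_comp v * y_comp u)" for u v
  proof -
    have D: "dird (\<lambda>q. - (h (fst q) * y_comp v)) p u =
        - (h ?q * (a ?q * x_comp u + b ?q * y_comp u) * y_comp v)" for u v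
      by (rule dird_eqI) (auto intro!: derivative_eq_intros derivs[OF p])
    show ?thesis unfolding ext_d1_def D by (simp add: algebra_simps)
  qed
  have d12: "ext_d1 (\<omega> 1 2) p u v = ext_d1 \<sigma> p u v - ext_d1 \<psi> p u v"
  proof -
    have "dird (\<lambda>q. \<sigma> q v - \<psi> q v) p u = dird (\<lambda>q. \<sigma> q v) p u - dird (\<lambda>q. \<psi> q v) p u" for u v
      by (intro dird_eqI has_derivative_diff has_derivative_dird smooth_on_differentiable[OF _ p]
          one_form_smooth[OF one_form_sigma] one_form_smooth[OF one_form_psi])
    then show ?thesis by (simp add: omega_eqs ext_d1_def)
  qed
  have up: "curv_form 1 2 p u v = K p * wedge11 (\<theta> 1) (\<theta> 2) p u v" "curv_form 3 4 p u v = 0"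
    "curv_form 1 3 p u v = 0" "curv_form 1 4 p u v = 0" "curv_form 2 3 p u v = 0" "curv_form 2 4 p u v = 0"
  proof -
    have "K p * (z_comp p * h ?q) * (z_comp p * h ?q) = - flat_laplacian (\<lambda>r. ln (h r)) ?q - 4 * (h ?q)\<^sup>2"
      using nz by (simp add: K_def field_simps power2_eq_square)
    then have "K p * wedge11 (\<theta> 1) (\<theta> 2) p u v
        = (- flat_laplacian (\<lambda>r. ln (h r)) ?q - 4 * (h ?q)\<^sup>2) * (x_comp u * y_comp v - x_comp v * y_comp u)"
      unfolding wedge11_def coframe_eqs by algebra
    moreover have "curv_form 1 2 p u v
        = (- flat_laplacian (\<lambda>r. ln (h r)) ?q - 4 * (h ?q)\<^sup>2) * (x_comp u * y_comp v - x_comp v * y_comp u)"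
      unfolding curv_form_def d12 ext_d1_psi[OF p] ext_d1_sigma[OF p] sum_4 wedge11_def
      by (simp add: \<omega>_def algebra_simps power2_eq_square)
    ultimately show "curv_form 1 2 p u v = K p * wedge11 (\<theta> 1) (\<theta> 2) p u v" by simp
    show "curv_form 3 4 p u v = 0"
      unfolding curv_form_def omega_eqs(2) ext_d1_psi[OF p] sum_4 wedge11_def
      by (simp add: \<omega>_def algebra_simps power2_eq_square)
    show "curv_form 1 3 p u v = 0" 
      unfolding curv_form_def omega_eqs(3) dy' sum_4 wedge11_def
      by (simp add: \<omega>_def \<sigma>_def algebra_simps)
    show "curv_form 1 4 p u v = 0" 
      unfolding curv_form_def omega_eqs(4) dx sum_4 wedge11_def
      by (simp add: \<omega>_def \<sigma>_def algebra_simps)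
    show "curv_form 2 3 p u v = 0" 
      unfolding curv_form_def omega_eqs(5) dx sum_4 wedge11_def
      by (simp add: \<omega>_def \<sigma>_def algebra_simps)
    show "curv_form 2 4 p u v = 0" 
      unfolding curv_form_def omega_eqs(6) dy sum_4 wedge11_def
      by (simp add: \<omega>_def \<sigma>_def algebra_simps)
  qed
  have diag: "curv_form i i p u v = 0" using curv_form_skew[OF p, of i i u v] by simp
  from exhaust_4[of i] exhaust_4[of j] show ?thesis
    using up curv_form_skew[OF p, of 2 1] curv_form_skew[OF p, of 3 1] curv_form_skew[OF p, of 4 1]
      curv_form_skew[OF p, of 3 2] curv_form_skew[OF p, of 4 2] curv_form_skew[OF p, of 4 3] diag
    by (elim disjE) simp_all
qed

sublocale planar_curvature M g \<theta> E \<omega> 1 2 K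
  by unfold_locales (simp, fact planar_curv_form)

section \<open>The two Hermitian structures and the Lee form\<close>

text \<open>The matrix of \<open>E\<^sub>1 \<mapsto> E\<^sub>2\<close>, \<open>E\<^sub>3 \<mapsto> \<epsilon> E\<^sub>4\<close>, where \<open>\<epsilon>\<close> is \<open>1\<close> or \<open>- 1\<close>.\<close>

definition rot :: "real \<Rightarrow> 4 \<Rightarrow> 4 \<Rightarrow> real" where
  "rot \<epsilon> i j = (if i = 2 \<and> j = 1 then 1 else if i = 1 \<and> j = 2 then - 1
    else if i = 4 \<and> j = 3 then \<epsilon> else if i = 3 \<and> j = 4 then - \<epsilon> else 0)"

lemma frame_complex_structure_rot:
  assumes "\<epsilon> = 1 \<or> \<epsilon> = - 1"
  shows "frame_complex_structure M g \<theta> E (rot \<epsilon>)"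
proof
  fix i j and a :: "4 \<Rightarrow> real"
  show "rot \<epsilon> i j = - rot \<epsilon> j i"
    using exhaust_4[of i] exhaust_4[of j] by (elim disjE) (simp_all add: rot_def)
  show "(\<Sum>j\<in>UNIV. rot \<epsilon> i j * (\<Sum>k\<in>UNIV. rot \<epsilon> j k * a k)) = - a i"
    using exhaust_4[of i] assms by (elim disjE) (simp_all add: rot_def sum_4)
qed

lemma form_rot:
  assumes "p \<in> M"
  shows "\<theta> 1 p (frame_endo (rot \<epsilon>) p v) = - \<theta> 2 p v" "\<theta> 2 p (frame_endo (rot \<epsilon>) p v) = \<theta> 1 p v"
    "\<theta> 3 p (frame_endo (rot \<epsilon>) p v) = - \<epsilon> * \<theta> 4 p v" "\<theta> 4 p (frame_endo (rot \<epsilon>) p v) = \<epsilon> * \<theta> 3 p v"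
  by (simp_all add: form_frame_endo[OF assms] sum_4 rot_def)

text \<open>The structure equations with \<open>h dx\<close> and \<open>h dy\<close> rewritten as multiples of the coframe. The forms
  \<open>\<omega>\<^sub>1\<^sub>2\<close> and \<open>\<psi>\<close> stay as they are: they enter only as factors that drop out below.\<close>

lemma structure_equations:
  assumes p: "p \<in> M"
  defines "w \<equiv> 1 / z_comp p"
  shows "ext_d1 (\<theta> 1) p u v = - wedge11 (\<omega> 1 2) (\<theta> 2) p u v
      + w * (wedge11 (\<theta> 2) (\<theta> 3) p u v - wedge11 (\<theta> 1) (\<theta> 4) p u v)"
    and "ext_d1 (\<theta> 2) p u v = wedge11 (\<omega> 1 2) (\<theta> 1) p u v
      - w * (wedge11 (\<theta> 1) (\<theta> 3) p u v + wedge11 (\<theta> 2) (\<theta> 4) p u v)"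
    and "ext_d1 (\<theta> 3) p u v = 2 * w * wedge11 (\<theta> 1) (\<theta> 2) p u v - wedge11 \<psi> (\<theta> 4) p u v"
    and "ext_d1 (\<theta> 4) p u v = wedge11 \<psi> (\<theta> 3) p u v"
proof -
  have "z_comp p \<noteq> 0" using M_D(2)[OF p] by simp
  then have hx: "h (fst p) * x_comp u = w * \<theta> 1 p u" "h (fst p) * y_comp u = w * \<theta> 2 p u" for u
    by (simp_all add: w_def coframe_eqs)
  have \<omega>: "\<omega> 2 1 p u = - \<omega> 1 2 p u" "\<omega> 1 3 p u = - (w * \<theta> 2 p u)" "\<omega> 1 4 p u = w * \<theta> 1 p u"
    "\<omega> 2 3 p u = w * \<theta> 1 p u" "\<omega> 2 4 p u = w * \<theta> 2 p u" "\<omega> 3 1 p u = w * \<theta> 2 p u"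
    "\<omega> 3 2 p u = - (w * \<theta> 1 p u)" "\<omega> 3 4 p u = \<psi> p u" "\<omega> 4 1 p u = - (w * \<theta> 1 p u)"
    "\<omega> 4 2 p u = - (w * \<theta> 2 p u)" "\<omega> 4 3 p u = - \<psi> p u" "\<omega> i i p u = 0" for u i
    using exhaust_4[of i] by (auto simp: \<omega>_def hx[symmetric])
  show "ext_d1 (\<theta> 1) p u v = - wedge11 (\<omega> 1 2) (\<theta> 2) p u v
      + w * (wedge11 (\<theta> 2) (\<theta> 3) p u v - wedge11 (\<theta> 1) (\<theta> 4) p u v)"
    unfolding ext_d1_theta[OF p] sum_4 wedge11_def \<omega> by (simp add: algebra_simps)
  show "ext_d1 (\<theta> 2) p u v = wedge11 (\<omega> 1 2) (\<theta> 1) p u v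
      - w * (wedge11 (\<theta> 1) (\<theta> 3) p u v + wedge11 (\<theta> 2) (\<theta> 4) p u v)"
    unfolding ext_d1_theta[OF p] sum_4 wedge11_def \<omega> by (simp add: algebra_simps)
  show "ext_d1 (\<theta> 3) p u v = 2 * w * wedge11 (\<theta> 1) (\<theta> 2) p u v - wedge11 \<psi> (\<theta> 4) p u v"
    unfolding ext_d1_theta[OF p] sum_4 wedge11_def \<omega> by (simp add: algebra_simps)
  show "ext_d1 (\<theta> 4) p u v = wedge11 \<psi> (\<theta> 3) p u v"
    unfolding ext_d1_theta[OF p] sum_4 wedge11_def \<omega> by (simp add: algebra_simps)
qed

text \<open>The forms \<open>\<theta>\<^sub>1 + i\<theta>\<^sub>2\<close> and \<open>\<epsilon>\<theta>\<^sub>3 + i\<theta>\<^sub>4\<close> span the forms of type \<open>(1, 0)\<close>, and by the structure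
  equations their differentials lie, up to multiples of \<open>\<theta>\<^sub>1 \<and> \<theta>\<^sub>2\<close>, which has type \<open>(1, 1)\<close>, in the
  ideal generated by them.\<close>

lemma hermitian_rot:
  assumes \<epsilon>: "\<epsilon> = 1 \<or> \<epsilon> = - 1"
  shows "hermitian_on M g (frame_endo (rot \<epsilon>))"
proof (rule frame_complex_structure.hermitian[OF frame_complex_structure_rot[OF \<epsilon>]])
  fix p i u v assume p: "p \<in> M"
  let ?J = "frame_endo (rot \<epsilon>) p"
  show "ext_d1 (\<theta> i) p u v - ext_d1 (\<theta> i) p (?J u) (?J v)
    + (\<Sum>j\<in>UNIV. rot \<epsilon> i j * (ext_d1 (\<theta> j) p (?J u) v + ext_d1 (\<theta> j) p u (?J v))) = 0"
    using exhaust_4[of i] \<epsilon>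
    by (elim disjE) (simp_all add: sum_4 rot_def structure_equations[OF p] wedge11_def
        form_rot[OF p] algebra_simps)
qed

lemma kahler_form_rot:
  "p \<in> M \<Longrightarrow> kahler_form g (frame_endo (rot \<epsilon>)) p u v
    = wedge11 (\<theta> 1) (\<theta> 2) p u v + \<epsilon> * wedge11 (\<theta> 3) (\<theta> 4) p u v"
  by (simp add: kahler_form_frame_endo sum_4 rot_def wedge11_def algebra_simps)

text \<open>\<open>d(\<theta>\<^sub>1 \<and> \<theta>\<^sub>2) = d(\<theta>\<^sub>3 \<and> \<theta>\<^sub>4) = (2/z) \<theta>\<^sub>4 \<and> \<theta>\<^sub>1 \<and> \<theta>\<^sub>2\<close>, so the two parts of the form add up for
  \<open>\<epsilon> = 1\<close> and cancel for \<open>\<epsilon> = - 1\<close>.\<close>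

lemma ext_d2_kahler_form_rot:
  assumes p: "p \<in> M"
  shows "ext_d2 (kahler_form g (frame_endo (rot \<epsilon>))) p u v w
    = 2 * (1 + \<epsilon>) / z_comp p * wedge12 (\<theta> 4) (wedge11 (\<theta> 1) (\<theta> 2)) p u v w"
proof -
  have "dird (\<lambda>q. kahler_form g (frame_endo (rot \<epsilon>)) q u v) p w
      = dird (\<lambda>q. wedge11 (\<theta> 1) (\<theta> 2) q u v) p w + \<epsilon> * dird (\<lambda>q. wedge11 (\<theta> 3) (\<theta> 4) q u v) p w" for u v w
  proof -
    have "smooth_on M (\<lambda>q. wedge11 (\<theta> i) (\<theta> j) q u v)" for i j
      unfolding wedge11_def by (intro smooth_on_diff smooth_on_mult open_M form_smooth)
    note d = has_derivative_dird[OF smooth_on_differentiable[OF this p]]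
    have "dird (\<lambda>q. kahler_form g (frame_endo (rot \<epsilon>)) q u v) p w
        = dird (\<lambda>q. wedge11 (\<theta> 1) (\<theta> 2) q u v + \<epsilon> * wedge11 (\<theta> 3) (\<theta> 4) q u v) p w"
      by (rule dird_cong_open[OF open_M p]) (rule kahler_form_rot)
    then show ?thesis
      unfolding dird_eqI[OF has_derivative_add[OF d has_derivative_mult_right[OF d]]] .
  qed
  then have "ext_d2 (kahler_form g (frame_endo (rot \<epsilon>))) p u v w
      = ext_d2 (wedge11 (\<theta> 1) (\<theta> 2)) p u v w + \<epsilon> * ext_d2 (wedge11 (\<theta> 3) (\<theta> 4)) p u v w"
    unfolding ext_d2_def by (simp add: algebra_simps)
  also have "\<dots> = 2 * (1 + \<epsilon>) * (1 / z_comp p) * wedge12 (\<theta> 4) (wedge11 (\<theta> 1) (\<theta> 2)) p u v w"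
    unfolding ext_d2_wedge11[OF open_M form form p] wedge12_def structure_equations[OF p] wedge11_def
    by algebra
  finally show ?thesis by simp
qed

lemma kahler_rot: "kahler_on M g (frame_endo (rot (- 1)))"
  unfolding kahler_on_def by (simp add: hermitian_rot ext_d2_kahler_form_rot)

lemma lee_form_rot: "is_lee_form_on M g (frame_endo (rot 1)) (\<lambda>p v. 2 / z_comp p * \<theta> 4 p v)"
  unfolding is_lee_form_on_def
proof (intro conjI ballI allI)
  show "one_form_on M (\<lambda>p v. 2 / z_comp p * \<theta> 4 p v)"
    using M_D(2) by (intro one_form_mult form smooth_M_intros) force
  fix p u v w assume p: "p \<in> M"
  show "ext_d2 (kahler_form g (frame_endo (rot 1))) p u v w =
      2 * wedge12 (\<lambda>p v. 2 / z_comp p * \<theta> 4 p v) (kahler_form g (frame_endo (rot 1))) p u v w"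
    unfolding ext_d2_kahler_form_rot[OF p] wedge12_def kahler_form_rot[OF p]
    by (simp add: wedge11_def algebra_simps)
qed

text \<open>The wedge product with a nondegenerate two-form is injective on one-forms in dimension four: the
  values of \<open>\<eta> \<and> \<Omega>\<close> on suitable triples of frame vectors are the components of \<open>\<eta>\<close>.\<close>

lemma lee_form_unique:
  assumes lee: "is_lee_form_on M g (frame_endo (rot 1)) \<eta>" and p: "p \<in> M"
  shows "\<eta> p v = 2 / z_comp p * \<theta> 4 p v"
proof -
  let ?\<Omega> = "kahler_form g (frame_endo (rot 1))" and ?L = "\<lambda>p v. 2 / z_comp p * \<theta> 4 p v"
  have eq: "wedge12 \<eta> ?\<Omega> p u v w = wedge12 ?L ?\<Omega> p u v w" for u v w
  proof -
    have "ext_d2 ?\<Omega> p u v w = 2 * wedge12 \<eta> ?\<Omega> p u v w" "ext_d2 ?\<Omega> p u v w = 2 * wedge12 ?L ?\<Omega> p u v w"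
      using lee lee_form_rot p unfolding is_lee_form_on_def by blast+
    then show ?thesis by linarith
  qed
  have E: "\<eta> p (E i p) = ?L p (E i p)" for i
    using eq[of "E 3 p" "E 4 p" "E 1 p"] eq[of "E 3 p" "E 4 p" "E 2 p"]
      eq[of "E 1 p" "E 2 p" "E 3 p"] eq[of "E 1 p" "E 2 p" "E 4 p"] exhaust_4[of i]
    unfolding wedge12_def kahler_form_rot[OF p] wedge11_def
    by (auto simp: dual[OF p])
  have "linear (\<eta> p)" "linear (?L p)"
    using lee lee_form_rot p by (simp_all add: is_lee_form_on_def one_form_on_def)
  from this[THEN linear_expand_frame[OF p], of v] show ?thesis by (simp only: E)
qed

lemma has_derivative_2_div_z:
  assumes "p \<in> M"
  shows "((\<lambda>q. 2 / z_comp q) has_derivative (\<lambda>u. - 2 * z_comp u / (z_comp p)\<^sup>2)) (at p)"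
proof -
  have "z_comp p \<noteq> 0" using M_D(2)[OF assms] by simp
  then show ?thesis
    by (auto intro!: derivative_eq_intros simp: power2_eq_square field_simps)
qed

text \<open>By uniqueness of the Lee form it suffices that \<open>(2/z) \<theta>\<^sub>4\<close> is not closed. At a point with \<open>z = - 1\<close>
  and \<open>t = 0\<close> its differential takes the value \<open>2 H\<close> on the coordinate fields
  \<open>\<partial>\<^sub>z\<close> and \<open>\<partial>\<^sub>y\<close>.\<close>

lemma not_locally_conformally_kahler: "\<not> locally_conformally_kahler_on M g (frame_endo (rot 1))"
proof
  assume "locally_conformally_kahler_on M g (frame_endo (rot 1))"
  then obtain \<eta> where lee: "is_lee_form_on M g (frame_endo (rot 1)) \<eta>"
    and closed: "\<And>p u v. p \<in> M \<Longrightarrow> ext_d1 \<eta> p u v = 0"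
    unfolding locally_conformally_kahler_on_def by blast
  obtain q where q: "q \<in> U" using U_nonempty by blast
  define p :: "(real \<times> real) \<times> (real \<times> real)" where "p = (q, (- 1, 0))"
  have p: "p \<in> M" using q by (simp add: p_def M_def)
  have D: "dird (\<lambda>q. \<eta> q v) p u = 2 / z_comp p * dird (\<lambda>q. \<theta> 4 q v) p u
      - 2 * z_comp u / (z_comp p)\<^sup>2 * \<theta> 4 p v" for u v
  proof -
    have "dird (\<lambda>q. \<eta> q v) p u = dird (\<lambda>q. 2 / z_comp q * \<theta> 4 q v) p u"
      by (rule dird_cong_open[OF open_M p]) (rule lee_form_unique[OF lee])
    then show ?thesis
      unfolding dird_eqI[OF has_derivative_mult[OF has_derivative_2_div_z[OF p]
          has_derivative_dird[OF smooth_on_differentiable[OF form_smooth p]]]] by simp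
  qed
  have "ext_d1 \<eta> p u v = 2 / z_comp p * ext_d1 (\<theta> 4) p u v
      - 2 / (z_comp p)\<^sup>2 * (z_comp u * \<theta> 4 p v - z_comp v * \<theta> 4 p u)" for u v
    unfolding ext_d1_def D by (simp add: algebra_simps)
  then have "2 / z_comp p * wedge11 \<psi> (\<theta> 3) p u v
      - 2 / (z_comp p)\<^sup>2 * (z_comp u * \<theta> 4 p v - z_comp v * \<theta> 4 p u) = 0" for u v
    using closed[OF p] by (simp only: structure_equations(4)[OF p])
  from this[of "((0, 0), (1, 0))" "((0, 1), (0, 0))"]
  have "H q = 0" by (simp add: wedge11_def coframe_eqs \<psi>_def p_def)
  with H_pos[OF q] show False by simp
qed

text \<open>Both terms are \<open>4 / z\<^sup>2\<close> up to sign: in the codifferential the connection forms contribute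
  \<open>- 6 / z\<^sup>2\<close> and the derivative of \<open>2/z\<close> contributes \<open>2 / z\<^sup>2\<close>.\<close>

lemma lee_form_codiff:
  assumes lee: "is_lee_form_on M g (frame_endo (rot 1)) \<eta>" and p: "p \<in> M"
  shows "form1_norm_sq g \<eta> p + codiff1 g \<eta> p = 0"
proof -
  note eq = lee_form_unique[OF lee]
  have z: "z_comp p \<noteq> 0" and hq: "h (fst p) \<noteq> 0" using M_D[OF p] h_pos[of "fst p"] by auto
  have "(\<lambda>q. 2 / z_comp q) differentiable (at p)"
    using has_derivative_2_div_z[OF p] by (auto simp: differentiable_def)
  then have "codiff1 g \<eta> p = 2 / z_comp p * (\<Sum>j\<in>UNIV. \<omega> 4 j p (E j p))
      - dird (\<lambda>q. 2 / z_comp q) p (E 4 p)"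
    by (rule codiff1_scaled_form[OF p]) (rule eq)
  also have "\<dots> = - 4 / (z_comp p)\<^sup>2"
    unfolding dird_eqI[OF has_derivative_2_div_z[OF p]] sum_4
    using z hq by (simp add: \<omega>_def E_def Let_def \<psi>_def field_simps power2_eq_square)
  finally show ?thesis
    by (simp add: form1_norm_sq_scaled_form[OF p eq] power_divide)
qed

lemma ricci_invariant_rot: "ricci_invariant_on M g (frame_endo (rot 1))"
  unfolding ricci_invariant_on_def by (simp add: ricci_eq form_rot algebra_simps)

lemma qch_rot: "qch_kahler_surface_on M g (frame_endo (rot (- 1)))"
proof (rule qch_kahler_surface)
  show "DIM((real \<times> real) \<times> (real \<times> real)) = 4" by simp
  show "kahler_on M g (frame_endo (rot (- 1)))" by (rule kahler_rot)
  \<comment> \<open>rewriting the Laplacian by the smooth functions \<open>a\<close> and \<open>b\<close> makes its smoothness visible\<close>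
  have "K = (\<lambda>p. - (d_x a (fst p) + d_y b (fst p)) / ((z_comp p)\<^sup>2 * (h (fst p))\<^sup>2) - 4 / (z_comp p)\<^sup>2)"
    by (simp add: K_def fun_eq_iff laplace_a_b)
  moreover have "z_comp p \<noteq> 0" "h (fst p) \<noteq> 0" if "p \<in> M" for p
    using M_D[OF that] h_pos[of "fst p"] by auto
  ultimately show "smooth_on M K"
    unfolding d_x_def d_y_def
    by (simp only:, intro smooth_M_intros smooth_base[of "\<lambda>q. dird _ q _"]) auto
  show "frame_endo (rot (- 1)) p (E 1 p) = E 2 p" if "p \<in> M" for p
  proof (rule coframe_eqI[OF that])
    show "\<theta> i p (frame_endo (rot (- 1)) p (E 1 p)) = \<theta> i p (E 2 p)" for i
      using exhaust_4[of i] by (auto simp: form_rot[OF that] dual[OF that])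
  qed
qed

end

section \<open>The semi-symmetric Kaehler surface and its second Hermitian structure\<close>

theorem theorem1:
  fixes U :: "(real \<times> real) set" and h H l2 n2 :: "real \<times> real \<Rightarrow> real"
    and g_Sigma \<omega>_Sigma :: "real \<times> real \<Rightarrow> real \<times> real \<Rightarrow> real \<times> real \<Rightarrow> real"
    and M :: "((real \<times> real) \<times> (real \<times> real)) set"
    and z_coord \<alpha> :: "(real \<times> real) \<times> (real \<times> real) \<Rightarrow> real"
    and \<theta>3 \<theta>4 :: "((real \<times> real) \<times> (real \<times> real)) form1"
    and g :: "((real \<times> real) \<times> (real \<times> real)) metric_tensor"
  assumes "open U" and "U \<noteq> {}"
    and "smooth_on U h" and "\<forall>q\<in>U. h q > 0"
    and "smooth_on U H" and "\<forall>q\<in>U. H q > 0"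
    and "\<forall>q\<in>U. flat_laplacian (\<lambda>r. ln (H r)) q = 2 * (h q)\<^sup>2"
    and g_Sigma: "g_Sigma = (\<lambda>q (dx, dy) (dx', dy'). (h q)\<^sup>2 * (dx * dx' + dy * dy'))"
    and \<omega>_Sigma: "\<omega>_Sigma = (\<lambda>q (dx, dy) (dx', dy'). (h q)\<^sup>2 * (dx * dy' - dx' * dy))"
    and l2: "l2 = (\<lambda>q. - d_y (\<lambda>r. ln (H r)) q)"
    and n2: "n2 = (\<lambda>q. d_x (\<lambda>r. ln (H r)) q)"
    and M: "M = U \<times> {(z, t). z < 0}"
    and z_coord: "z_coord = (\<lambda>((x, y), (z, t)). z)"
    and \<theta>3: "\<theta>3 = (\<lambda>((x, y), (z, t)) ((dx, dy), (dz, dt)).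
           - (z / 2) * dt
           + (cos (t / 2) * H (x, y) + z * l2 (x, y)) * dx
           + (- sin (t / 2) * H (x, y) + z * n2 (x, y)) * dy)"
    and \<theta>4: "\<theta>4 = (\<lambda>((x, y), (z, t)) ((dx, dy), (dz, dt)).
           dz - sin (t / 2) * H (x, y) * dx - cos (t / 2) * H (x, y) * dy)"
    and g: "g = (\<lambda>p u v. (z_coord p)\<^sup>2 * g_Sigma (fst p) (fst u) (fst v)
           + \<theta>3 p u * \<theta>3 p v + \<theta>4 p u * \<theta>4 p v)"
    and \<alpha>: "\<alpha> = (\<lambda>p. - 2 / z_coord p)"
  shows "\<exists>Jb J.
    kahler_on M g Jb \<and>
    (\<forall>p\<in>M. \<forall>u v. kahler_form g Jb p u v
        = (z_coord p)\<^sup>2 * \<omega>_Sigma (fst p) (fst u) (fst v) + wedge11 \<theta>4 \<theta>3 p u v) \<and>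
    hermitian_on M g J \<and>
    (\<forall>p\<in>M. \<forall>u v. kahler_form g J p u v
        = (z_coord p)\<^sup>2 * \<omega>_Sigma (fst p) (fst u) (fst v) + wedge11 \<theta>3 \<theta>4 p u v) \<and>
    ricci_invariant_on M g J \<and>
    \<not> locally_conformally_kahler_on M g J \<and>
    is_lee_form_on M g J (\<lambda>p v. - \<alpha> p * \<theta>4 p v) \<and>
    (\<forall>p\<in>M. scalar_curvature g p
        = - (2 * flat_laplacian (\<lambda>r. ln (h r)) (fst p)) / ((z_coord p)\<^sup>2 * (h (fst p))\<^sup>2)
          - 8 / (z_coord p)\<^sup>2) \<and>
    (\<forall>\<theta>. is_lee_form_on M g J \<theta> \<longrightarrow>
        (\<forall>p\<in>M. scalar_curvature g p = conformal_scalar_curvature g \<theta> p)) \<and>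
    semi_symmetric_on M g \<and>
    qch_kahler_surface_on M g Jb"
proof -
  interpret B: bundle_metric U h H
    using assms(1-7) by unfold_locales auto
  have z: "z_coord = (\<lambda>p. z_comp p)" by (simp add: z_coord fun_eq_iff)
  have M': "M = B.M" by (simp add: M B.M_def)
  have \<theta>3': "\<theta>3 = B.\<theta> 3"
    by (simp add: \<theta>3 l2 n2 fun_eq_iff B.coframe_eqs B.\<psi>_def B.l_def B.n_def algebra_simps)
  have \<theta>4': "\<theta>4 = B.\<theta> 4"
    by (simp add: \<theta>4 fun_eq_iff B.coframe_eqs algebra_simps)
  have \<omega>: "(z_coord p)\<^sup>2 * \<omega>_Sigma (fst p) (fst u) (fst v) = wedge11 (B.\<theta> 1) (B.\<theta> 2) p u v" for p u v
    by (simp add: z \<omega>_Sigma case_prod_beta B.coframe_eqs wedge11_def power2_eq_square algebra_simps)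
  have g': "g = B.g"
    by (simp add: g \<theta>3' \<theta>4' fun_eq_iff B.g_def sum_4)
      (simp add: z g_Sigma B.coframe_eqs power2_eq_square algebra_simps)
  have lee: "(\<lambda>p v. - \<alpha> p * \<theta>4 p v) = (\<lambda>p v. 2 / z_comp p * B.\<theta> 4 p v)"
    by (simp add: \<alpha> z \<theta>4')
  let ?Jb = "B.frame_endo (B.rot (- 1))" and ?J = "B.frame_endo (B.rot 1)"
  show ?thesis
    unfolding M' g' lee
  proof (rule exI[of _ ?Jb], rule exI[of _ ?J], intro conjI ballI allI impI)
    show "kahler_on B.M B.g ?Jb" by (rule B.kahler_rot)
    show "hermitian_on B.M B.g ?J" by (rule B.hermitian_rot) simp
    show "ricci_invariant_on B.M B.g ?J" by (rule B.ricci_invariant_rot)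
    show "\<not> locally_conformally_kahler_on B.M B.g ?J" by (rule B.not_locally_conformally_kahler)
    show "is_lee_form_on B.M B.g ?J (\<lambda>p v. 2 / z_comp p * B.\<theta> 4 p v)" by (rule B.lee_form_rot)
    show "semi_symmetric_on B.M B.g" by (rule B.semi_symmetric)
    show "qch_kahler_surface_on B.M B.g ?Jb" by (rule B.qch_rot)
  next
    fix p u v assume p: "p \<in> B.M"
    show "kahler_form B.g ?Jb p u v
        = (z_coord p)\<^sup>2 * \<omega>_Sigma (fst p) (fst u) (fst v) + wedge11 \<theta>4 \<theta>3 p u v"
      unfolding B.kahler_form_rot[OF p] \<omega> \<theta>3' \<theta>4' by (simp add: wedge11_def)
    show "kahler_form B.g ?J p u v
        = (z_coord p)\<^sup>2 * \<omega>_Sigma (fst p) (fst u) (fst v) + wedge11 \<theta>3 \<theta>4 p u v"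
      unfolding B.kahler_form_rot[OF p] \<omega> \<theta>3' \<theta>4' by simp
  next
    fix p assume p: "p \<in> B.M"
    show "scalar_curvature B.g p
        = - (2 * flat_laplacian (\<lambda>r. ln (h r)) (fst p)) / ((z_coord p)\<^sup>2 * (h (fst p))\<^sup>2)
          - 8 / (z_coord p)\<^sup>2"
      unfolding B.scalar_curvature_eq[OF p] B.K_def z by simp
    fix \<eta> assume "is_lee_form_on B.M B.g ?J \<eta>"
    from B.lee_form_codiff[OF this p] show "scalar_curvature B.g p = conformal_scalar_curvature B.g \<eta> p"
      by (simp add: conformal_scalar_curvature_def)
  qed
qed

end
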